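(* Let $U=\int_X^\oplus U_x\,d\mu(x)$ be a direct integral of real Hilbert spaces with $U_{x+\delta}=U_x$ and $U_{\check x}=U_x$ for all $\delta\in\Delta$ and almost all $x\in X$, let $V_x=\mathbb C\otimes U_x$, and let $(\mu,\nu,\mathcal C)$ be a Gårding–Wightman triple with this family $\{V_x\}$, $\nu(x)=\dim V_x$. If $\check\mu$ is equivalent to $\mu$, $\check\nu=\nu$, and the operators $c_k$ satisfy $$\overline{c_k(x)}=(-1)^kc_k(\check x)$$ for all $k\ge1$ and almost all $x\in X$, then $$V^{\mathbb R}=\Big\{f\in V:\overline{f(x)}=\sqrt{\tfrac{d\check\mu(x)}{d\mu(x)}}\,f(\check x)\Big\}$$ is an invariant real form of $V=V(\mu,\nu,\mathcal C)$.
   Context: $X=\mathbb Z_2^{\infty}$ is the compact abelian group of sequences $x=(x_1,x_2,\dots)$ of $0$'s and $1$'s with componentwise addition mod $2$, the product topology and its Borel $\sigma$-algebra. $\delta^k\in X$ has a $1$ in position $k$ and $0$ elsewhere; $\Delta\subset X$ is the subgroup of sequences with finitely many $1$'s. $\check x=x+(1,1,\dots)$; $\check\nu(x)=\nu(\check x)$ and $\check\mu(A)=\mu(\check A)$, $\check A=\{\check x:x\in A\}$. Measures are equivalent if mutually absolutely continuous. A Gårding–Wightman triple $(\mu,\nu,\mathcal C)$ consists of: (1) a $\sigma$-finite positive Borel measure $\mu$ on $X$, quasi-invariant under $\Delta$, i.e. for each $\delta\in\Delta$ the measure $A\mapsto\mu(A+\delta)$ is equivalent to $\mu$; (2) a measurable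 family $\{V_x\}$ of nonzero separable complex Hilbert spaces with $V_{x+\delta}=V_x$ for $\delta\in\Delta$ and almost all $x$, and $\nu(x)=\dim V_x$ measurable; (3) a family $\mathcal C=\{c_k(x):k\ge 1,x\in X\}$ of unitary operators $c_k(x):V_x\to V_{x+\delta^k}=V_x$, depending measurably on $x$, with $c_k(x)^*=c_k(x+\delta^k)$ and $c_k(x)c_l(x+\delta^k)=c_l(x)c_k(x+\delta^l)$ for all $k,l$ and almost all $x$. $V=V(\mu,\nu,\mathcal C)=\int_X^\oplus V_x\,d\mu(x)$ carries the mutually anticommuting unitary operators of square $-I$ ($k\ge1$) $$J_kf(x)=-i(-1)^{x_1+\dots+x_{k-1}}c_k(x)\sqrt{\tfrac{d\mu(x+\delta^k)}{d\mu(x)}}f(x+\delta^k),\quad J_k'f(x)=(-1)^{x_1+\dots+x_{k}}c_k(x)\sqrt{\tfrac{d\mu(x+\delta^k)}{d\mu(x)}}f(x+\delta^k),$$ where $d\mu(x+\delta^k)/d\mu(x)$ is the Radon–Nikodym derivative of $A\mapsto\mu(A+\delta^k)$ with respect to $\mu$. The bar denotes conjugation of $V_x=\mathbb C\otimes U_x$ with respect to $U_x$; for an operator $A$, $\overline A(v)=\overline{A(\bar v)}$. An invariant real form of $V$ is a set $\{v\in V:Sv=v\}$, where $S$ is a $\mathbb C$-antilinear norm-preserving operator with $S^2=I$ commuting with all $J_k,J_k'$. *)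

theory Defs
  imports
    "HOL-Analysis.Analysis"
    "HOL-Library.Z2"
    "HOL-Library.Function_Algebras"
    "HOL-Library.Extended_Nat"
begin

section \<open>Hilbert spaces as structures\<close>

text \<open>
  The fibres of a measurable family vary with the point, so a Hilbert space is a structure on a
  carrier set rather than a type. The scalars are \<^typ>\<open>real\<close> or \<^typ>\<open>complex\<close>; the parameter
  \<open>cj\<close> below is the conjugation of the scalar field. Inner products are linear in the first
  argument.
\<close>

record ('k, 'a) hspace =
  hcarrier :: "'a set"
  hzero :: 'a
  hadd :: "'a \<Rightarrow> 'a \<Rightarrow> 'a"
  hscale :: "'k \<Rightarrow> 'a \<Rightarrow> 'a"
  hinner :: "'a \<Rightarrow> 'a \<Rightarrow> 'k"

definition hnorm :: "('k::real_normed_field, 'a) hspace \<Rightarrow> 'a \<Rightarrow> real" where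
  "hnorm H v = sqrt (norm (hinner H v v))"

definition hdist :: "('k::real_normed_field, 'a) hspace \<Rightarrow> 'a \<Rightarrow> 'a \<Rightarrow> real" where
  "hdist H u v = hnorm H (hadd H u (hscale H (- 1) v))"

locale hilbert_space =
  fixes cj :: "'k::real_normed_field \<Rightarrow> 'k" and H :: "('k, 'a) hspace"
  assumes zero_closed: "hzero H \<in> hcarrier H"
    and add_closed: "\<lbrakk>u \<in> hcarrier H; v \<in> hcarrier H\<rbrakk> \<Longrightarrow> hadd H u v \<in> hcarrier H"
    and scale_closed: "u \<in> hcarrier H \<Longrightarrow> hscale H a u \<in> hcarrier H"
    and add_assoc: "\<lbrakk>u \<in> hcarrier H; v \<in> hcarrier H; w \<in> hcarrier H\<rbrakk>
      \<Longrightarrow> hadd H (hadd H u v) w = hadd H u (hadd H v w)"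
    and add_commute: "\<lbrakk>u \<in> hcarrier H; v \<in> hcarrier H\<rbrakk> \<Longrightarrow> hadd H u v = hadd H v u"
    and add_zero: "u \<in> hcarrier H \<Longrightarrow> hadd H (hzero H) u = u"
    and add_minus: "u \<in> hcarrier H \<Longrightarrow> hadd H u (hscale H (- 1) u) = hzero H"
    and scale_add_right: "\<lbrakk>u \<in> hcarrier H; v \<in> hcarrier H\<rbrakk>
      \<Longrightarrow> hscale H a (hadd H u v) = hadd H (hscale H a u) (hscale H a v)"
    and scale_add_left: "u \<in> hcarrier H
      \<Longrightarrow> hscale H (a + b) u = hadd H (hscale H a u) (hscale H b u)"
    and scale_scale: "u \<in> hcarrier H \<Longrightarrow> hscale H a (hscale H b u) = hscale H (a * b) u"
    and scale_one: "u \<in> hcarrier H \<Longrightarrow> hscale H 1 u = u"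
    and inner_add: "\<lbrakk>u \<in> hcarrier H; v \<in> hcarrier H; w \<in> hcarrier H\<rbrakk>
      \<Longrightarrow> hinner H (hadd H u v) w = hinner H u w + hinner H v w"
    and inner_scale: "\<lbrakk>u \<in> hcarrier H; v \<in> hcarrier H\<rbrakk>
      \<Longrightarrow> hinner H (hscale H a u) v = a * hinner H u v"
    and inner_conj: "\<lbrakk>u \<in> hcarrier H; v \<in> hcarrier H\<rbrakk> \<Longrightarrow> hinner H v u = cj (hinner H u v)"
    and inner_nonneg: "u \<in> hcarrier H \<Longrightarrow> \<exists>r\<ge>0. hinner H u u = of_real r"
    and inner_definite: "\<lbrakk>u \<in> hcarrier H; hinner H u u = 0\<rbrakk> \<Longrightarrow> u = hzero H"
    and complete: "\<lbrakk>\<And>n::nat. s n \<in> hcarrier H;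
        \<And>e. e > 0 \<Longrightarrow> \<exists>N. \<forall>m\<ge>N. \<forall>n\<ge>N. hdist H (s m) (s n) < e\<rbrakk>
      \<Longrightarrow> \<exists>l\<in>hcarrier H. (\<lambda>n. hdist H (s n) l) \<longlonglongrightarrow> 0"

text \<open>Equality of structures, ignoring the values of the operations outside the carrier.\<close>

definition hspace_eq :: "('k, 'a) hspace \<Rightarrow> ('k, 'a) hspace \<Rightarrow> bool" where
  "hspace_eq H K \<longleftrightarrow> hcarrier H = hcarrier K \<and> hzero H = hzero K \<and>
     (\<forall>u\<in>hcarrier H. \<forall>v\<in>hcarrier H. hadd H u v = hadd K u v) \<and>
     (\<forall>a. \<forall>u\<in>hcarrier H. hscale H a u = hscale K a u) \<and>
     (\<forall>u\<in>hcarrier H. \<forall>v\<in>hcarrier H. hinner H u v = hinner K u v)"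

inductive_set hspan :: "('k, 'a) hspace \<Rightarrow> 'a set \<Rightarrow> 'a set" for H B where
  span_zero: "hzero H \<in> hspan H B"
| span_base: "b \<in> B \<Longrightarrow> b \<in> hspan H B"
| span_add: "\<lbrakk>u \<in> hspan H B; v \<in> hspan H B\<rbrakk> \<Longrightarrow> hadd H u v \<in> hspan H B"
| span_scale: "u \<in> hspan H B \<Longrightarrow> hscale H a u \<in> hspan H B"

definition hdense :: "('k::real_normed_field, 'a) hspace \<Rightarrow> 'a set \<Rightarrow> bool" where
  "hdense H D \<longleftrightarrow> D \<subseteq> hcarrier H \<and> (\<forall>v\<in>hcarrier H. \<forall>e>0. \<exists>u\<in>D. hdist H v u < e)"

definition hseparable :: "('k::real_normed_field, 'a) hspace \<Rightarrow> bool" where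
  "hseparable H \<longleftrightarrow> (\<exists>D. countable D \<and> hdense H D)"

definition orthonormal_basis :: "('k::real_normed_field, 'a) hspace \<Rightarrow> 'a set \<Rightarrow> bool" where
  "orthonormal_basis H B \<longleftrightarrow> B \<subseteq> hcarrier H \<and>
     (\<forall>u\<in>B. \<forall>v\<in>B. hinner H u v = (if u = v then 1 else 0)) \<and> hdense H (hspan H B)"

text \<open>Intended for separable spaces, where \<open>\<infinity>\<close> means countably infinite.\<close>

definition hdim :: "('k::real_normed_field, 'a) hspace \<Rightarrow> enat" where
  "hdim H = (let B = (SOME B. orthonormal_basis H B)
             in if finite B then enat (card B) else \<infinity>)"

definition unitary_op ::
    "('k, 'a) hspace \<Rightarrow> ('k, 'b) hspace \<Rightarrow> ('a \<Rightarrow> 'b) \<Rightarrow> bool" where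
  "unitary_op H K T \<longleftrightarrow> bij_betw T (hcarrier H) (hcarrier K) \<and>
     (\<forall>u\<in>hcarrier H. \<forall>v\<in>hcarrier H. T (hadd H u v) = hadd K (T u) (T v)) \<and>
     (\<forall>a. \<forall>u\<in>hcarrier H. T (hscale H a u) = hscale K a (T u)) \<and>
     (\<forall>u\<in>hcarrier H. \<forall>v\<in>hcarrier H. hinner K (T u) (T v) = hinner H u v)"

text \<open>The pair \<open>(u, v)\<close> represents \<open>u + \<i> v\<close> in the complexification.\<close>

definition complexify :: "(real, 'a) hspace \<Rightarrow> (complex, 'a \<times> 'a) hspace" where
  "complexify H = \<lparr>
     hcarrier = hcarrier H \<times> hcarrier H,
     hzero = (hzero H, hzero H),
     hadd = (\<lambda>(u, v) (u', v'). (hadd H u u', hadd H v v')),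
     hscale = (\<lambda>a (u, v). (hadd H (hscale H (Re a) u) (hscale H (- Im a) v),
                           hadd H (hscale H (Re a) v) (hscale H (Im a) u))),
     hinner = (\<lambda>(u, v) (u', v'). Complex (hinner H u u' + hinner H v v')
                                         (hinner H v u' - hinner H u v'))\<rparr>"

definition conjugate :: "(real, 'a) hspace \<Rightarrow> 'a \<times> 'a \<Rightarrow> 'a \<times> 'a" where
  "conjugate H = (\<lambda>(u, v). (u, hscale H (- 1) v))"

definition conjugate_op :: "(real, 'a) hspace \<Rightarrow> ('a \<times> 'a \<Rightarrow> 'a \<times> 'a) \<Rightarrow> 'a \<times> 'a \<Rightarrow> 'a \<times> 'a" where
  "conjugate_op H A = (\<lambda>v. conjugate H (A (conjugate H v)))"


section \<open>Measurable families and direct integrals\<close>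

text \<open>
  A measurable family consists of the fibres together with the set of its measurable sections,
  axiomatized as by Dixmier. Everything is taken with respect to the given \<open>\<sigma>\<close>-algebra (not its
  completion); objects are then compared up to null sets.
\<close>

record ('x, 'k, 'a) hfamily =
  fiber :: "'x \<Rightarrow> ('k, 'a) hspace"
  msections :: "('x \<Rightarrow> 'a) set"

definition measurable_family :: "('k::{real_normed_field, banach, second_countable_topology} \<Rightarrow> 'k)
    \<Rightarrow> 'x measure \<Rightarrow> ('x, 'k, 'a) hfamily \<Rightarrow> bool" where
  "measurable_family cj M F \<longleftrightarrow>
     (\<forall>x\<in>space M. hilbert_space cj (fiber F x)) \<and>
     (\<forall>s\<in>msections F. \<forall>x\<in>space M. s x \<in> hcarrier (fiber F x)) \<and>
     (\<forall>s\<in>msections F. \<forall>t\<in>msections F. (\<lambda>x. hadd (fiber F x) (s x) (t x)) \<in> msections F) \<and>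
     (\<forall>a. \<forall>s\<in>msections F. (\<lambda>x. hscale (fiber F x) a (s x)) \<in> msections F) \<and>
     (\<forall>s\<in>msections F. (\<lambda>x. hnorm (fiber F x) (s x)) \<in> borel_measurable M) \<and>
     (\<forall>t. (\<forall>x\<in>space M. t x \<in> hcarrier (fiber F x)) \<and>
          (\<forall>s\<in>msections F. (\<lambda>x. hinner (fiber F x) (s x) (t x)) \<in> borel_measurable M)
          \<longrightarrow> t \<in> msections F) \<and>
     (\<exists>e::nat \<Rightarrow> 'x \<Rightarrow> 'a. range e \<subseteq> msections F \<and>
        (\<forall>x\<in>space M. hdense (fiber F x) (hspan (fiber F x) (range (\<lambda>n. e n x)))))"

definition pullback :: "('y \<Rightarrow> 'x) \<Rightarrow> ('x, 'k, 'a) hfamily \<Rightarrow> ('y, 'k, 'a) hfamily" where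
  "pullback \<phi> F = \<lparr>fiber = (\<lambda>y. fiber F (\<phi> y)), msections = (\<lambda>s y. s (\<phi> y)) ` msections F\<rparr>"

text \<open>Almost everywhere equality of measurable families: of the fibres and of the measurable
  sections.\<close>

definition family_ae_eq :: "'x measure \<Rightarrow> ('x, 'k, 'a) hfamily \<Rightarrow> ('x, 'k, 'a) hfamily \<Rightarrow> bool" where
  "family_ae_eq M F G \<longleftrightarrow>
     (AE x in M. hspace_eq (fiber F x) (fiber G x)) \<and>
     (\<forall>s\<in>msections F. \<exists>t\<in>msections G. AE x in M. s x = t x) \<and>
     (\<forall>t\<in>msections G. \<exists>s\<in>msections F. AE x in M. s x = t x)"

definition complexify_family :: "('x, real, 'a) hfamily \<Rightarrow> ('x, complex, 'a \<times> 'a) hfamily" where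
  "complexify_family U = \<lparr>fiber = (\<lambda>x. complexify (fiber U x)),
     msections = {\<lambda>x. (s x, t x) | s t. s \<in> msections U \<and> t \<in> msections U}\<rparr>"

text \<open>The measurable sections agreeing almost everywhere with a given function.\<close>

definition ae_class :: "'x measure \<Rightarrow> ('x, 'k, 'a) hfamily \<Rightarrow> ('x \<Rightarrow> 'a) \<Rightarrow> ('x \<Rightarrow> 'a) set" where
  "ae_class M F f = {g \<in> msections F. AE x in M. g x = f x}"

definition rep :: "('x \<Rightarrow> 'a) set \<Rightarrow> 'x \<Rightarrow> 'a" where
  "rep A = (SOME f. f \<in> A)"

definition on_classes :: "'x measure \<Rightarrow> ('x, 'k, 'a) hfamily \<Rightarrow> (('x \<Rightarrow> 'a) \<Rightarrow> ('x \<Rightarrow> 'a))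
    \<Rightarrow> ('x \<Rightarrow> 'a) set \<Rightarrow> ('x \<Rightarrow> 'a) set" where
  "on_classes M F T A = ae_class M F (T (rep A))"

definition direct_integral :: "'x measure
    \<Rightarrow> ('x, 'k::{real_normed_field, banach, second_countable_topology}, 'a) hfamily
    \<Rightarrow> ('k, ('x \<Rightarrow> 'a) set) hspace" where
  "direct_integral M F = \<lparr>
     hcarrier = {ae_class M F f | f. f \<in> msections F \<and>
                   integrable M (\<lambda>x. (hnorm (fiber F x) (f x))\<^sup>2)},
     hzero = ae_class M F (\<lambda>x. hzero (fiber F x)),
     hadd = (\<lambda>A B. ae_class M F (\<lambda>x. hadd (fiber F x) (rep A x) (rep B x))),
     hscale = (\<lambda>a A. ae_class M F (\<lambda>x. hscale (fiber F x) a (rep A x))),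
     hinner = (\<lambda>A B. LINT x|M. hinner (fiber F x) (rep A x) (rep B x))\<rparr>"


section \<open>The group of binary sequences\<close>

instantiation bit :: discrete_topology
begin

definition open_bit :: "bit set \<Rightarrow> bool" where
  "open_bit A \<longleftrightarrow> True"

instance
  by standard (auto simp: open_bit_def)

end

text \<open>
  Addition is pointwise, and the topology is the product topology. Positions in the mathematics
  start at 1, whereas arguments of a sequence start at 0: the entry \<open>x\<^sub>k\<close>, for \<open>k \<ge> 1\<close>, is
  \<open>x (k - 1)\<close>.
\<close>

type_synonym binseq = "nat \<Rightarrow> bit"

definition entry :: "binseq \<Rightarrow> nat \<Rightarrow> bit" where
  "entry x k = x (k - 1)"

definition \<delta> :: "nat \<Rightarrow> binseq" where
  "\<delta> k = (\<lambda>j. if j = k - 1 then 1 else 0)"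

definition \<Delta> :: "binseq set" where
  "\<Delta> = {d. finite {j. d j = 1}}"

definition check :: "binseq \<Rightarrow> binseq" where
  "check x = x + (\<lambda>_. 1)"

definition entry_sum :: "binseq \<Rightarrow> nat \<Rightarrow> nat" where
  "entry_sum x n = (\<Sum>k=1..n. of_bool (entry x k = 1))"

text \<open>Since \<open>-d = d\<close> and \<^const>\<open>check\<close> is an involution, preimages are images here:
  \<open>translate \<mu> d\<close> is \<open>A \<mapsto> \<mu> (A + d)\<close>, and \<open>check_measure \<mu>\<close> sends \<open>A\<close> to the measure of its
  image under \<^const>\<open>check\<close>.\<close>

definition translate :: "binseq measure \<Rightarrow> binseq \<Rightarrow> binseq measure" where
  "translate \<mu> d = distr \<mu> borel (\<lambda>x. x + d)"

definition check_measure :: "binseq measure \<Rightarrow> binseq measure" where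
  "check_measure \<mu> = distr \<mu> borel check"

definition equivalent_measures :: "'x measure \<Rightarrow> 'x measure \<Rightarrow> bool" where
  "equivalent_measures M N \<longleftrightarrow> absolutely_continuous M N \<and> absolutely_continuous N M"

text \<open>The derivative \<open>dN/dM\<close>, real valued.\<close>

definition rn_derivative :: "'x measure \<Rightarrow> 'x measure \<Rightarrow> 'x \<Rightarrow> real" where
  "rn_derivative N M x = enn2real (RN_deriv M N x)"


section \<open>Garding--Wightman triples\<close>

definition gw_triple :: "binseq measure \<Rightarrow> (binseq, complex, 'a) hfamily \<Rightarrow> (binseq \<Rightarrow> enat)
    \<Rightarrow> (nat \<Rightarrow> binseq \<Rightarrow> 'a \<Rightarrow> 'a) \<Rightarrow> bool" where
  "gw_triple \<mu> V \<nu> c \<longleftrightarrow>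
     sigma_finite_measure \<mu> \<and> sets \<mu> = sets borel \<and>
     (\<forall>d\<in>\<Delta>. equivalent_measures (translate \<mu> d) \<mu>) \<and>
     measurable_family cnj \<mu> V \<and>
     (\<forall>x. hcarrier (fiber V x) \<noteq> {hzero (fiber V x)} \<and> hseparable (fiber V x)) \<and>
     (\<forall>d\<in>\<Delta>. family_ae_eq \<mu> (pullback (\<lambda>x. x + d) V) V) \<and>
     (\<forall>x. \<nu> x = hdim (fiber V x)) \<and> \<nu> \<in> measurable \<mu> (count_space UNIV) \<and>
     (\<forall>k\<ge>1. AE x in \<mu>. unitary_op (fiber V x) (fiber V (x + \<delta> k)) (c k x)) \<and>
     (\<forall>k\<ge>1. \<forall>s\<in>msections V. \<exists>t\<in>msections V. AE x in \<mu>. t x = c k x (s x)) \<and>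
     (\<forall>k\<ge>1. AE x in \<mu>. \<forall>u\<in>hcarrier (fiber V x). \<forall>v\<in>hcarrier (fiber V x).
        hinner (fiber V x) (c k x u) v = hinner (fiber V x) u (c k (x + \<delta> k) v)) \<and>
     (\<forall>k\<ge>1. \<forall>l\<ge>1. AE x in \<mu>. \<forall>v\<in>hcarrier (fiber V x).
        c k x (c l (x + \<delta> k) v) = c l x (c k (x + \<delta> l) v))"

text \<open>For \<open>k \<ge> 1\<close>, first on sections and then, through \<^const>\<open>on_classes\<close>, on the direct
  integral.\<close>

definition J_fun :: "binseq measure \<Rightarrow> (binseq, complex, 'a) hfamily \<Rightarrow> (nat \<Rightarrow> binseq \<Rightarrow> 'a \<Rightarrow> 'a)
    \<Rightarrow> nat \<Rightarrow> (binseq \<Rightarrow> 'a) \<Rightarrow> binseq \<Rightarrow> 'a" where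
  "J_fun \<mu> V c k f x = hscale (fiber V x)
     (- \<i> * (- 1) ^ entry_sum x (k - 1) * of_real (sqrt (rn_derivative (translate \<mu> (\<delta> k)) \<mu> x)))
     (c k x (f (x + \<delta> k)))"

definition J'_fun :: "binseq measure \<Rightarrow> (binseq, complex, 'a) hfamily \<Rightarrow> (nat \<Rightarrow> binseq \<Rightarrow> 'a \<Rightarrow> 'a)
    \<Rightarrow> nat \<Rightarrow> (binseq \<Rightarrow> 'a) \<Rightarrow> binseq \<Rightarrow> 'a" where
  "J'_fun \<mu> V c k f x = hscale (fiber V x)
     ((- 1) ^ entry_sum x k * of_real (sqrt (rn_derivative (translate \<mu> (\<delta> k)) \<mu> x)))
     (c k x (f (x + \<delta> k)))"

definition J :: "binseq measure \<Rightarrow> (binseq, complex, 'a) hfamily \<Rightarrow> (nat \<Rightarrow> binseq \<Rightarrow> 'a \<Rightarrow> 'a)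
    \<Rightarrow> nat \<Rightarrow> (binseq \<Rightarrow> 'a) set \<Rightarrow> (binseq \<Rightarrow> 'a) set" where
  "J \<mu> V c k = on_classes \<mu> V (J_fun \<mu> V c k)"

definition J' :: "binseq measure \<Rightarrow> (binseq, complex, 'a) hfamily \<Rightarrow> (nat \<Rightarrow> binseq \<Rightarrow> 'a \<Rightarrow> 'a)
    \<Rightarrow> nat \<Rightarrow> (binseq \<Rightarrow> 'a) set \<Rightarrow> (binseq \<Rightarrow> 'a) set" where
  "J' \<mu> V c k = on_classes \<mu> V (J'_fun \<mu> V c k)"

definition invariant_real_form ::
    "(complex, 'b) hspace \<Rightarrow> ('b \<Rightarrow> 'b) set \<Rightarrow> 'b set \<Rightarrow> bool" where
  "invariant_real_form H Ops R \<longleftrightarrow> (\<exists>S.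
     (\<forall>v\<in>hcarrier H. S v \<in> hcarrier H) \<and>
     (\<forall>u\<in>hcarrier H. \<forall>v\<in>hcarrier H. S (hadd H u v) = hadd H (S u) (S v)) \<and>
     (\<forall>a. \<forall>v\<in>hcarrier H. S (hscale H a v) = hscale H (cnj a) (S v)) \<and>
     (\<forall>v\<in>hcarrier H. hnorm H (S v) = hnorm H v) \<and>
     (\<forall>v\<in>hcarrier H. S (S v) = v) \<and>
     (\<forall>T\<in>Ops. \<forall>v\<in>hcarrier H. S (T v) = T (S v)) \<and>
     R = {v \<in> hcarrier H. S v = v})"

definition real_form_set :: "binseq measure \<Rightarrow> (binseq, real, 'a) hfamily
    \<Rightarrow> (binseq \<Rightarrow> 'a \<times> 'a) set set" where
  "real_form_set \<mu> U = {A \<in> hcarrier (direct_integral \<mu> (complexify_family U)).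
     \<exists>f\<in>A. AE x in \<mu>. conjugate (fiber U x) (f x) =
       hscale (complexify (fiber U x)) (of_real (sqrt (rn_derivative (check_measure \<mu>) \<mu> x)))
         (f (check x))}"

end

theory Submission
  imports Defs
begin

text \<open>
  The antiunitary symmetry is \<open>(S f)(x) = sqrt (D x) * conj (f (check x))\<close> with
  \<open>D = d(check \<mu>)/d\<mu>\<close>: its fixed points are the elements of the real form, and the change of
  variables \<open>x \<mapsto> check x\<close> makes it norm-preserving. Both \<open>S\<^sup>2 = I\<close> and the commutation with the
  \<open>J\<^sub>k\<close>, \<open>J\<^sub>k'\<close> rest on the cocycle identity for the Radon-Nikodym derivatives of two commuting
  quasi-invariant involutions. In the commutation, \<open>check\<close> changes the sign
  \<open>(-1)\<^bsup>x\<^sub>1 + \<dots> + x\<^sub>n\<^esup>\<close> by \<open>(-1)\<^sup>n\<close>, with \<open>n = k\<close> for \<open>J\<^sub>k'\<close> and \<open>n = k - 1\<close> for \<open>J\<^sub>k\<close>, where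
  conjugating the factor \<open>-\<i>\<close> supplies the missing sign; the hypothesis on \<open>c\<^sub>k\<close> absorbs the total
  \<open>(-1)\<^sup>k\<close>.
\<close>

section \<open>Quasi-invariant measurable involutions\<close>

text \<open>Absolute continuity in one direction already amounts to equivalence: pushing it forward
  along \<open>T\<close> exchanges the two measures, since \<open>T\<close> is its own
  inverse.\<close>

locale quasi_invariant_involution = sigma_finite_measure M for M :: "'x measure" +
  fixes T :: "'x \<Rightarrow> 'x"
  assumes involution_measurable: "T \<in> measurable M M"
    and involution: "x \<in> space M \<Longrightarrow> T (T x) = x"
    and image_abs_cont: "absolutely_continuous M (distr M M T)"
begin

abbreviation jacobian :: "'x \<Rightarrow> real" where
  "jacobian \<equiv> rn_derivative (distr M M T) M"

text \<open>An \<open>M\<close>-null exceptional set is null for the image measure too, and that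
  says its preimage under \<open>T\<close> is \<open>M\<close>-null. Almost everywhere hypotheses
  may therefore be evaluated at \<open>check x\<close> or \<open>x + \<delta> k\<close>.\<close>

lemma AE_involution:
  assumes "AE x in M. P x"
  shows "AE x in M. P (T x)"
  using AE_distrD[OF involution_measurable] absolutely_continuous_AE[OF _ image_abs_cont assms]
  by simp

lemma jacobian_measurable [measurable]: "jacobian \<in> borel_measurable M"
  unfolding rn_derivative_def by measurable

lemma jacobian_nonneg [simp]: "0 \<le> jacobian x"
  by (simp add: rn_derivative_def)

lemma distr_distr_involution: "distr (distr M M T) M T = M"
proof -
  have "distr (distr M M T) M T = distr M M (T \<circ> T)"
    by (rule distr_distr) (use involution_measurable in auto)
  also have "\<dots> = distr M M (\<lambda>x. x)"
    by (rule distr_cong) (auto simp: involution)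
  finally show ?thesis by simp
qed

text \<open>The derivative must be finite almost everywhere, because \<open>rn_derivative\<close>
  turns the value infinity into 0. Finiteness follows from sigma-finiteness of the image measure,
  which \<open>T\<close> carries back to \<open>M\<close>.\<close>

lemma density_jacobian: "density M (\<lambda>x. ennreal (jacobian x)) = distr M M T"
proof -
  have "sigma_finite_measure (distr M M T)"
    by (rule sigma_finite_measure_distr[where f = T and N = M])
      (use distr_distr_involution involution_measurable sigma_finite_measure_axioms in auto)
  then have "AE x in M. RN_deriv M (distr M M T) x \<noteq> \<infinity>"
    by (rule RN_deriv_finite) (auto simp: image_abs_cont)
  then have "AE x in M. ennreal (jacobian x) = RN_deriv M (distr M M T) x"
    by eventually_elim (auto simp: rn_derivative_def less_top)
  then have "density M (\<lambda>x. ennreal (jacobian x)) = density M (RN_deriv M (distr M M T))"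
    by (intro density_cong) (auto simp del: space_distr)
  also have "\<dots> = distr M M T"
    by (rule density_RN_deriv) (auto simp: image_abs_cont)
  finally show ?thesis .
qed

lemma nn_integral_involution:
  assumes [measurable]: "g \<in> borel_measurable M"
  shows "(\<integral>\<^sup>+x. g (T x) \<partial>M) = (\<integral>\<^sup>+x. ennreal (jacobian x) * g x \<partial>M)"
proof -
  have "(\<integral>\<^sup>+x. g (T x) \<partial>M) = (\<integral>\<^sup>+x. g x \<partial>distr M M T)"
    by (subst nn_integral_distr) (use involution_measurable in auto)
  also have "\<dots> = (\<integral>\<^sup>+x. ennreal (jacobian x) * g x \<partial>M)"
    by (subst density_jacobian[symmetric], subst nn_integral_density) auto
  finally show ?thesis .
qed

text \<open>The substitution that makes the symmetry norm-preserving: against the image measure the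
  integrand is \<open>g (T x)\<close>, and pulling back along \<open>T\<close> once more cancels the
  two applications. Vector-valued \<open>g\<close> covers both real squared norms and complex inner
  products.\<close>

lemma
  fixes g :: "'x \<Rightarrow> 'b::{banach, second_countable_topology}"
  assumes g [measurable]: "g \<in> borel_measurable M"
  shows integrable_involution: "integrable M (\<lambda>x. jacobian x *\<^sub>R g (T x)) \<longleftrightarrow> integrable M g"
    and integral_involution: "(LINT x|M. jacobian x *\<^sub>R g (T x)) = (LINT x|M. g x)"
proof -
  note [measurable] = involution_measurable
  have eq: "g (T (T x)) = g x" if "x \<in> space M" for x
    using that by (simp add: involution)
  have "integrable M (\<lambda>x. jacobian x *\<^sub>R g (T x)) \<longleftrightarrow> integrable (distr M M T) (\<lambda>x. g (T x))"
    by (subst density_jacobian[symmetric], subst integrable_density) auto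
  also have "\<dots> \<longleftrightarrow> integrable M (\<lambda>x. g (T (T x)))"
    by (subst integrable_distr_eq) auto
  also have "\<dots> \<longleftrightarrow> integrable M g"
    by (rule Bochner_Integration.integrable_cong) (auto simp: eq)
  finally show "integrable M (\<lambda>x. jacobian x *\<^sub>R g (T x)) \<longleftrightarrow> integrable M g" .
  have "(LINT x|M. jacobian x *\<^sub>R g (T x)) = (LINT x|distr M M T. g (T x))"
    by (subst density_jacobian[symmetric], subst integral_density) auto
  also have "\<dots> = (LINT x|M. g (T (T x)))"
    by (subst integral_distr) auto
  also have "\<dots> = (LINT x|M. g x)"
    by (rule Bochner_Integration.integral_cong) (auto simp: eq)
  finally show "(LINT x|M. jacobian x *\<^sub>R g (T x)) = (LINT x|M. g x)" .
qed

end

text \<open>Chain rule for image measures, obtained by testing against indicators and substituting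
  \<open>T\<close> first, then \<open>S\<close>.\<close>

lemma density_jacobian_compose:
  assumes S: "quasi_invariant_involution M S" and T: "quasi_invariant_involution M T"
  shows "density M (\<lambda>x. ennreal (rn_derivative (distr M M S) M x * rn_derivative (distr M M T) M (S x)))
    = distr M M (S \<circ> T)"
proof (rule measure_eqI)
  interpret S: quasi_invariant_involution M S by fact
  interpret T: quasi_invariant_involution M T by fact
  note [measurable] = S.involution_measurable T.involution_measurable
  fix A assume "A \<in> sets (density M (\<lambda>x. ennreal (S.jacobian x * T.jacobian (S x))))"
  then have A [measurable]: "A \<in> sets M" by simp
  have "emeasure (distr M M (S \<circ> T)) A = (\<integral>\<^sup>+x. indicator A x \<partial>distr M M (S \<circ> T))"
    by simp
  also have "\<dots> = (\<integral>\<^sup>+x. indicator A (S (T x)) \<partial>M)"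
    by (subst nn_integral_distr) auto
  also have "\<dots> = (\<integral>\<^sup>+x. ennreal (T.jacobian x) * indicator A (S x) \<partial>M)"
    by (rule T.nn_integral_involution) auto
  \<comment> \<open>Writing \<open>x\<close> as \<open>S (S x)\<close> makes the whole integrand a
    function of \<open>S x\<close>, so that the substitution for \<open>S\<close> applies.\<close>
  also have "\<dots> = (\<integral>\<^sup>+x. ennreal (T.jacobian (S (S x))) * indicator A (S x) \<partial>M)"
    by (rule nn_integral_cong) (simp add: S.involution)
  also have "\<dots> = (\<integral>\<^sup>+x. ennreal (S.jacobian x) * (ennreal (T.jacobian (S x)) * indicator A x) \<partial>M)"
    by (rule S.nn_integral_involution) auto
  also have "\<dots> = emeasure (density M (\<lambda>x. ennreal (S.jacobian x * T.jacobian (S x)))) A"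
    by (subst emeasure_density) (auto simp: ennreal_mult mult.assoc)
  finally show "emeasure (density M (\<lambda>x. ennreal (S.jacobian x * T.jacobian (S x)))) A =
      emeasure (distr M M (S \<circ> T)) A" ..
qed simp

text \<open>By the chain rule the two products are densities of the images under
  \<open>S \<circ> T\<close> and \<open>T \<circ> S\<close>. These images coincide, and densities
  over a sigma-finite measure are unique almost everywhere.\<close>

lemma jacobian_cocycle:
  assumes S: "quasi_invariant_involution M S" and T: "quasi_invariant_involution M T"
    and commute: "\<And>x. x \<in> space M \<Longrightarrow> S (T x) = T (S x)"
  shows "AE x in M. rn_derivative (distr M M S) M x * rn_derivative (distr M M T) M (S x) =
    rn_derivative (distr M M T) M x * rn_derivative (distr M M S) M (T x)"
proof -
  interpret S: quasi_invariant_involution M S by fact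
  interpret T: quasi_invariant_involution M T by fact
  note [measurable] = S.involution_measurable T.involution_measurable
  have "distr M M (S \<circ> T) = distr M M (T \<circ> S)"
    by (rule distr_cong) (auto simp: commute)
  then have "AE x in M. ennreal (S.jacobian x * T.jacobian (S x)) =
      ennreal (T.jacobian x * S.jacobian (T x))"
    using density_jacobian_compose[OF S T] density_jacobian_compose[OF T S]
    by (subst S.density_unique_iff[symmetric]) auto
  then show ?thesis
    by eventually_elim (simp add: ennreal_inj)
qed

text \<open>The chain rule with both maps equal to \<open>T\<close> exhibits the product as a
  density of \<open>M\<close> with respect to itself.\<close>

lemma (in quasi_invariant_involution) jacobian_involution:
  "AE x in M. jacobian x * jacobian (T x) = 1"
proof -
  note [measurable] = involution_measurable
  have "distr M M (T \<circ> T) = distr M M (\<lambda>x. x)"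
    by (rule distr_cong) (auto simp: involution)
  then have "density M (\<lambda>x. ennreal (jacobian x * jacobian (T x))) = density M (\<lambda>_. 1)"
    using density_jacobian_compose[OF quasi_invariant_involution_axioms quasi_invariant_involution_axioms]
    by (simp add: density_1)
  then have "AE x in M. ennreal (jacobian x * jacobian (T x)) = 1"
    by (subst density_unique_iff[symmetric]) auto
  then show ?thesis
    by eventually_elim (simp flip: ennreal_1 add: ennreal_inj)
qed

section \<open>Complexification and conjugation\<close>

context hilbert_space
begin

lemma norm_squared: "u \<in> hcarrier H \<Longrightarrow> hinner H u u = of_real ((hnorm H u)\<^sup>2)"
  using inner_nonneg[of u] by (auto simp: hnorm_def)

lemma inner_scale_right:
  assumes "\<And>a b. cj (a * b) = cj a * cj b" "u \<in> hcarrier H" "v \<in> hcarrier H"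
  shows "hinner H u (hscale H a v) = cj a * hinner H u v"
proof -
  have "hinner H u (hscale H a v) = cj (hinner H (hscale H a v) u)"
    by (rule inner_conj) (simp_all add: assms scale_closed)
  also have "\<dots> = cj (a * hinner H v u)"
    by (subst inner_scale) (simp_all add: assms)
  also have "\<dots> = cj a * hinner H u v"
    by (simp only: inner_conj[OF assms(3,2)] assms(1))
  finally show ?thesis .
qed

lemma inner_add_right:
  assumes "\<And>a b. cj (a + b) = cj a + cj b" "u \<in> hcarrier H" "v \<in> hcarrier H" "w \<in> hcarrier H"
  shows "hinner H u (hadd H v w) = hinner H u v + hinner H u w"
proof -
  have "hinner H u (hadd H v w) = cj (hinner H (hadd H v w) u)"
    by (rule inner_conj) (simp_all add: assms add_closed)
  also have "\<dots> = cj (hinner H v u + hinner H w u)"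
    by (subst inner_add) (simp_all add: assms)
  also have "\<dots> = hinner H u v + hinner H u w"
    by (simp only: inner_conj[OF assms(3,2)] inner_conj[OF assms(4,2)] assms(1))
  finally show ?thesis .
qed

end

text \<open>A measurable family guarantees measurability only for norms of its sections;
  polarization carries this over to inner products.\<close>

lemma Re_inner_polarization:
  assumes "hilbert_space cnj H" and u: "u \<in> hcarrier H" and v: "v \<in> hcarrier H"
  shows "Re (hinner H u v) = ((hnorm H (hadd H u v))\<^sup>2 - (hnorm H u)\<^sup>2 - (hnorm H v)\<^sup>2) / 2"
proof -
  interpret hilbert_space cnj H by fact
  have "hinner H (hadd H u v) (hadd H u v) =
      hinner H u u + hinner H u v + (cnj (hinner H u v) + hinner H v v)"
    using u v by (simp add: inner_add inner_add_right add_closed inner_conj[of u v])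
  then have "complex_of_real ((hnorm H (hadd H u v))\<^sup>2) =
      of_real ((hnorm H u)\<^sup>2) + hinner H u v + (cnj (hinner H u v) + of_real ((hnorm H v)\<^sup>2))"
    using u v by (simp add: norm_squared add_closed)
  from arg_cong[OF this, of Re] show ?thesis by simp
qed

text \<open>The second argument is the antilinear one, so \<open>\<i>\<close> leaves it as
  \<open>- \<i>\<close>, and the real part of \<open>- \<i> * z\<close> is the imaginary part of
  \<open>z\<close>.\<close>

lemma Im_inner_polarization:
  assumes "hilbert_space cnj H" and u: "u \<in> hcarrier H" and v: "v \<in> hcarrier H"
  shows "Im (hinner H u v) = Re (hinner H u (hscale H \<i> v))"
proof -
  interpret hilbert_space cnj H by fact
  show ?thesis using u v by (simp add: inner_scale_right)
qed

lemma conjugate_closed: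
  assumes "hilbert_space (\<lambda>a::real. a) H" "u \<in> hcarrier (complexify H)"
  shows "conjugate H u \<in> hcarrier (complexify H)"
proof -
  interpret hilbert_space "\<lambda>a. a" H by fact
  show ?thesis using assms(2) by (auto simp: conjugate_def complexify_def scale_closed)
qed

lemma conjugate_conjugate:
  assumes "hilbert_space (\<lambda>a::real. a) H" "u \<in> hcarrier (complexify H)"
  shows "conjugate H (conjugate H u) = u"
proof -
  interpret hilbert_space "\<lambda>a. a" H by fact
  show ?thesis using assms(2) by (auto simp: conjugate_def complexify_def scale_scale scale_one)
qed

lemma conjugate_add:
  assumes "hilbert_space (\<lambda>a::real. a) H" "u \<in> hcarrier (complexify H)" "v \<in> hcarrier (complexify H)"
  shows "conjugate H (hadd (complexify H) u v) =
    hadd (complexify H) (conjugate H u) (conjugate H v)"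
proof -
  interpret hilbert_space "\<lambda>a. a" H by fact
  show ?thesis using assms(2,3) by (auto simp: conjugate_def complexify_def scale_add_right)
qed

lemma conjugate_scale:
  assumes "hilbert_space (\<lambda>a::real. a) H" "u \<in> hcarrier (complexify H)"
  shows "conjugate H (hscale (complexify H) a u) = hscale (complexify H) (cnj a) (conjugate H u)"
proof -
  interpret hilbert_space "\<lambda>a. a" H by fact
  show ?thesis
    using assms(2)
    by (auto simp: conjugate_def complexify_def scale_add_right scale_scale scale_closed)
qed

lemma inner_conjugate:
  assumes "hilbert_space (\<lambda>a::real. a) H" "u \<in> hcarrier (complexify H)" "v \<in> hcarrier (complexify H)"
  shows "hinner (complexify H) (conjugate H u) (conjugate H v) = cnj (hinner (complexify H) u v)"
proof -
  interpret hilbert_space "\<lambda>a. a" H by fact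
  show ?thesis
    using assms(2,3)
    by (auto simp: conjugate_def complexify_def inner_scale inner_scale_right scale_closed complex_cnj)
qed

text \<open>\<open>hspace_eq\<close> compares operations on the carrier only, while complex scaling
  adds vectors that were scaled before. Closure under scaling, from the Hilbert space hypothesis,
  keeps these intermediate vectors in the carrier.\<close>

lemma hspace_eq_complexify:
  assumes "hspace_eq H K" "hilbert_space (\<lambda>a::real. a) H"
  shows "hspace_eq (complexify H) (complexify K)"
proof -
  interpret hilbert_space "\<lambda>a. a" H by fact
  have eq: "hcarrier K = hcarrier H" "hzero K = hzero H"
      "\<And>u v. u \<in> hcarrier H \<Longrightarrow> v \<in> hcarrier H \<Longrightarrow> hadd K u v = hadd H u v"
      "\<And>a u. u \<in> hcarrier H \<Longrightarrow> hscale K a u = hscale H a u"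
      "\<And>u v. u \<in> hcarrier H \<Longrightarrow> v \<in> hcarrier H \<Longrightarrow> hinner K u v = hinner H u v"
    using assms(1) by (auto simp: hspace_eq_def)
  show ?thesis
    by (auto simp: hspace_eq_def complexify_def eq scale_closed)
qed

lemma hspace_eq_conjugate:
  assumes "hspace_eq H K" "u \<in> hcarrier (complexify H)"
  shows "conjugate H u = conjugate K u"
  using assms by (auto simp: hspace_eq_def conjugate_def complexify_def)

section \<open>Measurable sections and their classes\<close>

context
  fixes cj :: "'k::{real_normed_field, banach, second_countable_topology} \<Rightarrow> 'k"
    and M :: "'x measure" and F :: "('x, 'k, 'a) hfamily"
  assumes F: "measurable_family cj M F"
begin

lemma measurable_family_hilbert_space: "x \<in> space M \<Longrightarrow> hilbert_space cj (fiber F x)"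
  using F unfolding measurable_family_def by (elim conjE) (rule bspec)

lemma msections_closed: "s \<in> msections F \<Longrightarrow> x \<in> space M \<Longrightarrow> s x \<in> hcarrier (fiber F x)"
  using F unfolding measurable_family_def by (elim conjE) (drule (1) bspec)+

lemma msections_add:
  assumes "s \<in> msections F" "t \<in> msections F"
  shows "(\<lambda>x. hadd (fiber F x) (s x) (t x)) \<in> msections F"
proof -
  have "\<forall>s\<in>msections F. \<forall>t\<in>msections F. (\<lambda>x. hadd (fiber F x) (s x) (t x)) \<in> msections F"
    using F unfolding measurable_family_def by (elim conjE)
  with assms show ?thesis by (elim ballE) auto
qed

lemma msections_scale:
  assumes "s \<in> msections F"
  shows "(\<lambda>x. hscale (fiber F x) a (s x)) \<in> msections F"
proof -
  have "\<forall>a. \<forall>s\<in>msections F. (\<lambda>x. hscale (fiber F x) a (s x)) \<in> msections F"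
    using F unfolding measurable_family_def by (elim conjE)
  with assms show ?thesis by (elim allE ballE) auto
qed

lemma msections_norm_measurable:
  assumes "s \<in> msections F"
  shows "(\<lambda>x. hnorm (fiber F x) (s x)) \<in> borel_measurable M"
proof -
  have "\<forall>s\<in>msections F. (\<lambda>x. hnorm (fiber F x) (s x)) \<in> borel_measurable M"
    using F unfolding measurable_family_def by (elim conjE)
  with assms show ?thesis by (elim ballE) auto
qed

lemma msectionsI:
  assumes "\<And>x. x \<in> space M \<Longrightarrow> t x \<in> hcarrier (fiber F x)"
    and "\<And>s. s \<in> msections F \<Longrightarrow> (\<lambda>x. hinner (fiber F x) (s x) (t x)) \<in> borel_measurable M"
  shows "t \<in> msections F"
proof -
  have "(\<forall>x\<in>space M. t x \<in> hcarrier (fiber F x)) \<and>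
      (\<forall>s\<in>msections F. (\<lambda>x. hinner (fiber F x) (s x) (t x)) \<in> borel_measurable M)"
    using assms by simp
  moreover have "\<forall>t. (\<forall>x\<in>space M. t x \<in> hcarrier (fiber F x)) \<and>
      (\<forall>s\<in>msections F. (\<lambda>x. hinner (fiber F x) (s x) (t x)) \<in> borel_measurable M)
      \<longrightarrow> t \<in> msections F"
    using F unfolding measurable_family_def by (elim conjE)
  ultimately show ?thesis by (elim allE[of _ t] mp)
qed

end

lemma msections_inner_measurable:
  assumes F: "measurable_family cnj M F" and s: "s \<in> msections F" and t: "t \<in> msections F"
  shows "(\<lambda>x. hinner (fiber F x) (s x) (t x)) \<in> borel_measurable M"
proof -
  \<comment> \<open>Stated for every section \<open>t\<close>, so that it also serves
    \<open>\<i>\<close> times the given section, whose real part is the imaginary part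
    sought.\<close>
  have Re: "(\<lambda>x. Re (hinner (fiber F x) (s x) (t x))) \<in> borel_measurable M"
    if t: "t \<in> msections F" for t
  proof -
    have "(\<lambda>x. ((hnorm (fiber F x) (hadd (fiber F x) (s x) (t x)))\<^sup>2 -
        (hnorm (fiber F x) (s x))\<^sup>2 - (hnorm (fiber F x) (t x))\<^sup>2) / 2) \<in> borel_measurable M"
      by (intro borel_measurable_divide borel_measurable_diff borel_measurable_power
          borel_measurable_const msections_norm_measurable[OF F] msections_add[OF F] s t)
    moreover have "Re (hinner (fiber F x) (s x) (t x)) =
        ((hnorm (fiber F x) (hadd (fiber F x) (s x) (t x)))\<^sup>2 -
        (hnorm (fiber F x) (s x))\<^sup>2 - (hnorm (fiber F x) (t x))\<^sup>2) / 2" if "x \<in> space M" for x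
      by (intro Re_inner_polarization measurable_family_hilbert_space[OF F]
          msections_closed[OF F] s t that)
    ultimately show ?thesis by (subst measurable_cong)
  qed
  have "Im (hinner (fiber F x) (s x) (t x)) =
      Re (hinner (fiber F x) (s x) (hscale (fiber F x) \<i> (t x)))" if "x \<in> space M" for x
    by (intro Im_inner_polarization measurable_family_hilbert_space[OF F]
        msections_closed[OF F] s t that)
  then have "(\<lambda>x. Im (hinner (fiber F x) (s x) (t x))) \<in> borel_measurable M"
    using Re[OF msections_scale[OF F t, of \<i>]] by (simp cong: measurable_cong)
  with Re[OF t] show ?thesis
    by (simp add: borel_measurable_complex_iff)
qed

text \<open>Closure under constant scalars is an axiom; a measurable scalar function requires the
  saturation axiom \<open>msectionsI\<close>. Pairing with a section \<open>s\<close> only produces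
  the measurable factor \<open>cnj (h x)\<close>.\<close>

lemma msections_scale_measurable:
  assumes F: "measurable_family cnj M F" and t: "t \<in> msections F"
    and h: "h \<in> borel_measurable M"
  shows "(\<lambda>x. hscale (fiber F x) (h x) (t x)) \<in> msections F"
proof (rule msectionsI[OF F])
  fix x assume "x \<in> space M"
  then show "hscale (fiber F x) (h x) (t x) \<in> hcarrier (fiber F x)"
    by (intro hilbert_space.scale_closed[OF measurable_family_hilbert_space[OF F]]
        msections_closed[OF F t])
next
  fix s assume s: "s \<in> msections F"
  have "(\<lambda>x. cnj (h x) * hinner (fiber F x) (s x) (t x)) \<in> borel_measurable M"
    using borel_measurable_continuous_onI[OF continuous_on_cnj[OF continuous_on_id]]
    by (intro borel_measurable_times msections_inner_measurable[OF F s t]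
        measurable_compose[OF h, where g = cnj]) auto
  moreover have "hinner (fiber F x) (s x) (hscale (fiber F x) (h x) (t x)) =
      cnj (h x) * hinner (fiber F x) (s x) (t x)" if "x \<in> space M" for x
    by (intro hilbert_space.inner_scale_right[OF measurable_family_hilbert_space[OF F]]
        msections_closed[OF F] s t that complex_cnj_mult)
  ultimately show "(\<lambda>x. hinner (fiber F x) (s x) (hscale (fiber F x) (h x) (t x))) \<in> borel_measurable M"
    by (simp cong: measurable_cong)
qed

text \<open>Composing a section with \<open>check\<close> or with a translation gives a function
  that is a section only up to a null set. The notion marks the functions whose
  \<open>ae_class\<close> is nonempty, so that \<open>rep\<close> makes a meaningful choice.\<close>

definition ae_section :: "'x measure \<Rightarrow> ('x, 'k, 'a) hfamily \<Rightarrow> ('x \<Rightarrow> 'a) \<Rightarrow> bool" where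
  "ae_section M F f \<longleftrightarrow> (\<exists>g\<in>msections F. AE x in M. g x = f x)"

lemma ae_sectionI: "f \<in> msections F \<Longrightarrow> ae_section M F f"
  unfolding ae_section_def by (rule bexI[of _ f]) simp_all

lemma ae_section_cong:
  assumes "AE x in M. f x = g x" "ae_section M F f"
  shows "ae_section M F g"
proof -
  from assms(2) obtain h where "h \<in> msections F" "AE x in M. h x = f x"
    unfolding ae_section_def by (elim bexE)
  moreover from this(2) assms(1) have "AE x in M. h x = g x" by eventually_elim simp
  ultimately show ?thesis unfolding ae_section_def by (intro bexI[of _ h])
qed

lemma ae_class_cong:
  assumes "AE x in M. f x = g x"
  shows "ae_class M F f = ae_class M F g"
proof -
  have "(AE x in M. h x = f x) \<longleftrightarrow> (AE x in M. h x = g x)" for h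
    by (rule eventually_cong[OF assms]) simp
  then show ?thesis by (simp add: ae_class_def)
qed

lemma
  assumes "ae_section M F f"
  shows rep_ae_class_msections: "rep (ae_class M F f) \<in> msections F"
    and AE_rep_ae_class: "AE x in M. rep (ae_class M F f) x = f x"
proof -
  from assms obtain g where "g \<in> msections F" "AE x in M. g x = f x"
    unfolding ae_section_def by (elim bexE)
  then have "g \<in> ae_class M F f" by (simp add: ae_class_def)
  then have "rep (ae_class M F f) \<in> ae_class M F f"
    unfolding rep_def by (rule someI[where P = "\<lambda>g. g \<in> ae_class M F f"])
  then show "rep (ae_class M F f) \<in> msections F" "AE x in M. rep (ae_class M F f) x = f x"
    by (simp_all add: ae_class_def)
qed

text \<open>The hypothesis rules out that both classes are empty, hence equal for unrelated
  functions. Otherwise a common member agrees almost everywhere with both \<open>f\<close> and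
  \<open>g\<close>.\<close>

lemma ae_class_eq_iff:
  assumes "ae_section M F f"
  shows "ae_class M F f = ae_class M F g \<longleftrightarrow> (AE x in M. f x = g x)"
proof
  assume eq: "ae_class M F f = ae_class M F g"
  from assms obtain h where "h \<in> msections F" "AE x in M. h x = f x"
    unfolding ae_section_def by (elim bexE)
  then have h: "h \<in> ae_class M F f" by (simp add: ae_class_def)
  from h have "AE x in M. h x = f x" by (simp add: ae_class_def)
  moreover from h eq have "h \<in> ae_class M F g" by simp
  then have "AE x in M. h x = g x" by (simp add: ae_class_def)
  ultimately
  show "AE x in M. f x = g x" by eventually_elim simp
qed (rule ae_class_cong)

lemma on_classes_ae_class:
  assumes "\<And>f g. AE x in M. f x = g x \<Longrightarrow> AE x in M. T f x = T g x" "ae_section M F f"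
  shows "on_classes M F T (ae_class M F f) = ae_class M F (T f)"
  unfolding on_classes_def by (intro ae_class_cong assms(1) AE_rep_ae_class assms(2))

lemma direct_integral_add:
  assumes "ae_section M F f" "ae_section M F g"
  shows "hadd (direct_integral M F) (ae_class M F f) (ae_class M F g) =
    ae_class M F (\<lambda>x. hadd (fiber F x) (f x) (g x))"
proof -
  have "AE x in M. hadd (fiber F x) (rep (ae_class M F f) x) (rep (ae_class M F g) x) =
      hadd (fiber F x) (f x) (g x)"
    using AE_rep_ae_class[OF assms(1)] AE_rep_ae_class[OF assms(2)] by eventually_elim simp
  then show ?thesis by (simp add: direct_integral_def ae_class_cong)
qed

lemma direct_integral_scale:
  assumes "ae_section M F f"
  shows "hscale (direct_integral M F) a (ae_class M F f) =
    ae_class M F (\<lambda>x. hscale (fiber F x) a (f x))"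
proof -
  have "AE x in M. hscale (fiber F x) a (rep (ae_class M F f) x) = hscale (fiber F x) a (f x)"
    using AE_rep_ae_class[OF assms] by eventually_elim simp
  then show ?thesis by (simp add: direct_integral_def ae_class_cong)
qed

text \<open>Members of \<open>msections\<close> are required, not merely functions satisfying
  \<open>ae_section\<close>: exchanging integrands almost everywhere needs both to be measurable,
  and the sigma-algebra need not be complete.\<close>

lemma direct_integral_inner:
  assumes F: "measurable_family cnj M F" and f: "f \<in> msections F" and g: "g \<in> msections F"
  shows "hinner (direct_integral M F) (ae_class M F f) (ae_class M F g) =
    (LINT x|M. hinner (fiber F x) (f x) (g x))"
proof -
  note f' = ae_sectionI[OF f, of M] and g' = ae_sectionI[OF g, of M]
  have "AE x in M. hinner (fiber F x) (rep (ae_class M F f) x) (rep (ae_class M F g) x) =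
      hinner (fiber F x) (f x) (g x)"
    using AE_rep_ae_class[OF f'] AE_rep_ae_class[OF g'] by eventually_elim simp
  then show ?thesis
    by (simp add: direct_integral_def,
        intro integral_cong_AE msections_inner_measurable[OF F] f g
          rep_ae_class_msections f' g')
qed

lemma direct_integral_carrierE:
  assumes "A \<in> hcarrier (direct_integral M F)"
  obtains f where "f \<in> msections F" "A = ae_class M F f"
    "integrable M (\<lambda>x. (hnorm (fiber F x) (f x))\<^sup>2)"
  using assms by (auto simp: direct_integral_def)

section \<open>The group of binary sequences\<close>

lemma bit_add_self: "a + a = 0" for a :: bit
  by (cases a) simp_all

lemma check_check [simp]: "check (check x) = x"
  by (simp add: check_def fun_eq_iff add.assoc bit_add_self)

lemma add_delta_add_delta [simp]: "x + \<delta> k + \<delta> k = x"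
  by (simp add: fun_eq_iff add.assoc bit_add_self)

lemma check_add: "check (x + d) = check x + d"
  by (simp add: check_def fun_eq_iff ac_simps)

lemma delta_in_Delta: "\<delta> k \<in> \<Delta>"
proof -
  have "{j. \<delta> k j = 1} \<subseteq> {k - 1}" by (auto simp: \<delta>_def)
  then show ?thesis unfolding \<Delta>_def by (auto intro: finite_subset)
qed

lemma add_binseq_measurable: "(\<lambda>x. x + d) \<in> measurable borel borel" for d :: binseq
proof (intro borel_measurable_continuous_onI continuous_on_coordinatewise_then_product)
  fix i
  have "continuous_on UNIV ((\<lambda>b. b + d i) \<circ> (\<lambda>x. x i))"
    by (intro continuous_on_compose Topological_Spaces.continuous_on_discrete continuous_on_product_coordinates)
  then show "continuous_on UNIV (\<lambda>x. (x + d) i)" by (simp add: o_def)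
qed

lemma check_measurable: "check \<in> measurable borel borel"
  unfolding check_def by (rule add_binseq_measurable)

text \<open>At each position exactly one of \<open>x\<close> and \<open>check x\<close> has entry
  1.\<close>

lemma entry_sum_check: "entry_sum (check x) n + entry_sum x n = n"
proof -
  have "entry_sum (check x) n + entry_sum x n = (\<Sum>k=1..n. 1)"
    unfolding entry_sum_def sum.distrib[symmetric]
  proof (rule sum.cong)
    fix k
    show "of_bool (entry (check x) k = 1) + of_bool (entry x k = 1) = (1::nat)"
      by (cases "x (k - 1)") (simp_all add: entry_def check_def)
  qed simp
  then show ?thesis by simp
qed

lemma sign_entry_sum_check:
  "(- 1) ^ entry_sum (check x) n = (- 1) ^ n * (- 1 :: 'a::comm_ring_1) ^ entry_sum x n"
proof -
  \<comment> \<open>The exponent \<open>n\<close> splits into the two entry sums, after which the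
    sign belonging to \<open>x\<close> occurs squared.\<close>
  have "(- 1) ^ n * (- 1) ^ entry_sum x n =
      (- 1) ^ entry_sum (check x) n * ((- 1) ^ entry_sum x n * (- 1) ^ entry_sum x n :: 'a)"
    by (subst (1) entry_sum_check[of x n, symmetric]) (simp only: power_add mult.assoc)
  then show ?thesis by (simp flip: power_mult_distrib)
qed

text \<open>The sign is a finite product of functions of one coordinate each, and these are
  continuous because \<open>bit\<close> is discrete.\<close>

lemma sign_entry_sum_measurable:
  "(\<lambda>x. (- 1) ^ entry_sum x n :: complex) \<in> borel_measurable borel"
proof -
  have "(\<lambda>x::binseq. (if entry x k = 1 then - 1 else 1) :: complex) \<in> borel_measurable borel" for k
  proof -
    have "continuous_on UNIV ((\<lambda>b. (if b = 1 then - 1 else 1) :: complex) \<circ> (\<lambda>x::binseq. x (k - 1)))"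
      by (intro continuous_on_compose Topological_Spaces.continuous_on_discrete continuous_on_product_coordinates)
    then show ?thesis
      by (intro borel_measurable_continuous_onI) (simp add: o_def entry_def)
  qed
  then have "(\<lambda>x. \<Prod>k=1..n. (if entry x k = 1 then - 1 else 1) :: complex) \<in> borel_measurable borel"
    by (rule borel_measurable_prod)
  moreover have "(- 1) ^ entry_sum x n = (\<Prod>k=1..n. (if entry x k = 1 then - 1 else 1) :: complex)" for x
    unfolding entry_sum_def power_sum by (rule prod.cong) auto
  ultimately show ?thesis by simp
qed

text \<open>Reconciles image measures formed over \<open>borel\<close>, as for
  \<open>translate\<close> and \<open>check_measure\<close>, with those formed over
  \<open>\<mu>\<close> itself.\<close>

lemma quasi_invariant_involution_distr:
  assumes "sigma_finite_measure \<mu>" "sets \<mu> = sets borel"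
    and "T \<in> measurable borel borel" "\<And>x. T (T x) = x"
    and "equivalent_measures (distr \<mu> borel T) \<mu>"
  shows "quasi_invariant_involution \<mu> T"
proof -
  have "distr \<mu> borel T = distr \<mu> \<mu> T"
    by (rule distr_cong) (use assms in auto)
  moreover have "T \<in> measurable \<mu> \<mu>"
    using assms(2,3) by (simp cong: measurable_cong_sets)
  ultimately show ?thesis
    using assms by (auto simp: quasi_invariant_involution_def quasi_invariant_involution_axioms_def
        equivalent_measures_def)
qed

section \<open>The antilinear symmetry\<close>

lemma
  assumes "hspace_eq H K"
  shows hspace_eq_carrier: "hcarrier H = hcarrier K"
    and hspace_eq_add: "u \<in> hcarrier H \<Longrightarrow> v \<in> hcarrier H \<Longrightarrow> hadd H u v = hadd K u v"
    and hspace_eq_scale: "u \<in> hcarrier H \<Longrightarrow> hscale H a u = hscale K a u"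
    and hspace_eq_inner: "u \<in> hcarrier H \<Longrightarrow> v \<in> hcarrier H \<Longrightarrow> hinner H u v = hinner K u v"
  using assms by (auto simp: hspace_eq_def)

lemma hspace_eq_trans: "hspace_eq H K \<Longrightarrow> hspace_eq K L \<Longrightarrow> hspace_eq H L"
  by (auto simp: hspace_eq_def)

lemma family_ae_eq_section:
  assumes "family_ae_eq M F G" "s \<in> msections F"
  shows "\<exists>t\<in>msections G. AE x in M. s x = t x"
proof -
  have "\<forall>s\<in>msections F. \<exists>t\<in>msections G. AE x in M. s x = t x"
    using assms(1) unfolding family_ae_eq_def by (elim conjE)
  then show ?thesis using assms(2) by (rule bspec)
qed

lemma fiber_complexify_family [simp]: "fiber (complexify_family U) x = complexify (fiber U x)"
  by (simp add: complexify_family_def)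

locale conjugation_symmetric_triple =
  fixes \<mu> :: "binseq measure"
    and U :: "(binseq, real, 'u) hfamily"
    and \<nu> :: "binseq \<Rightarrow> enat"
    and c :: "nat \<Rightarrow> binseq \<Rightarrow> 'u \<times> 'u \<Rightarrow> 'u \<times> 'u"
  assumes U_family: "measurable_family (\<lambda>a::real. a) \<mu> U"
    and U_translate: "\<forall>d\<in>\<Delta>. family_ae_eq \<mu> (pullback (\<lambda>x. x + d) U) U"
    and U_check: "family_ae_eq \<mu> (pullback check U) U"
    and triple: "gw_triple \<mu> (complexify_family U) \<nu> c"
    and check_equivalent: "equivalent_measures (check_measure \<mu>) \<mu>"
    and c_conjugate: "\<forall>k\<ge>1. AE x in \<mu>. \<forall>v\<in>hcarrier (complexify (fiber U x)).
           conjugate_op (fiber U x) (c k x) v =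
             hscale (complexify (fiber U x)) ((- 1) ^ k) (c k (check x) v)"
begin

abbreviation V :: "(binseq, complex, 'u \<times> 'u) hfamily" where
  "V \<equiv> complexify_family U"

abbreviation VC :: "binseq \<Rightarrow> (complex, 'u \<times> 'u) hspace" where
  "VC x \<equiv> complexify (fiber U x)"

section \<open>Measure-theoretic and fibrewise data of the triple\<close>

lemma sigma_finite: "sigma_finite_measure \<mu>"
  using triple unfolding gw_triple_def by (elim conjE)

lemma sets_\<mu>: "sets \<mu> = sets borel"
  using triple unfolding gw_triple_def by (elim conjE)

lemma V_family: "measurable_family cnj \<mu> V"
  using triple unfolding gw_triple_def by (elim conjE)

lemma translate_equivalent: "\<forall>d\<in>\<Delta>. equivalent_measures (translate \<mu> d) \<mu>"
  using triple unfolding gw_triple_def by (elim conjE)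

lemma V_translate: "\<forall>d\<in>\<Delta>. family_ae_eq \<mu> (pullback (\<lambda>x. x + d) V) V"
  using triple unfolding gw_triple_def by (elim conjE)

lemma c_unitary: "\<forall>k\<ge>1. AE x in \<mu>. unitary_op (fiber V x) (fiber V (x + \<delta> k)) (c k x)"
  using triple unfolding gw_triple_def by (elim conjE)

lemma c_section: "\<forall>k\<ge>1. \<forall>s\<in>msections V. \<exists>t\<in>msections V. AE x in \<mu>. t x = c k x (s x)"
  using triple unfolding gw_triple_def by (elim conjE)

lemma space_\<mu> [simp]: "space \<mu> = UNIV"
  using sets_eq_imp_space_eq[OF sets_\<mu>] by simp

lemma measurable_\<mu>: "f \<in> measurable borel N \<Longrightarrow> f \<in> measurable \<mu> N"
  by (subst measurable_cong_sets[OF sets_\<mu> refl])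

lemma U_hilbert [simp]: "hilbert_space (\<lambda>a::real. a) (fiber U x)"
  using measurable_family_hilbert_space[OF U_family] by simp

lemma V_hilbert: "hilbert_space cnj (VC x)"
  using measurable_family_hilbert_space[OF V_family, of x] by simp

lemma V_closed: "f \<in> msections V \<Longrightarrow> f x \<in> hcarrier (VC x)"
  using msections_closed[OF V_family, of f x] by simp

lemma V_scale_closed: "u \<in> hcarrier (VC x) \<Longrightarrow> hscale (VC x) a u \<in> hcarrier (VC x)"
  using hilbert_space.scale_closed[OF V_hilbert] .

lemma check_involution: "quasi_invariant_involution \<mu> check"
  using check_equivalent
  by (intro quasi_invariant_involution_distr sigma_finite sets_\<mu> check_measurable)
    (simp_all add: check_measure_def)

lemma translate_involution: "quasi_invariant_involution \<mu> (\<lambda>x. x + \<delta> k)"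
  using translate_equivalent delta_in_Delta[of k]
  by (intro quasi_invariant_involution_distr sigma_finite sets_\<mu> add_binseq_measurable)
    (simp_all add: translate_def)

lemma check_measure_eq: "check_measure \<mu> = distr \<mu> \<mu> check"
  unfolding check_measure_def by (rule distr_cong) (simp_all add: sets_\<mu>)

lemma translate_eq: "translate \<mu> d = distr \<mu> \<mu> (\<lambda>x. x + d)"
  unfolding translate_def by (rule distr_cong) (simp_all add: sets_\<mu>)

section \<open>Radon-Nikodym densities and exceptional null sets\<close>

abbreviation D :: "binseq \<Rightarrow> real" where
  "D \<equiv> rn_derivative (check_measure \<mu>) \<mu>"

abbreviation R :: "nat \<Rightarrow> binseq \<Rightarrow> real" where
  "R k \<equiv> rn_derivative (translate \<mu> (\<delta> k)) \<mu>"

lemma D_nonneg [simp]: "0 \<le> D x" and R_nonneg [simp]: "0 \<le> R k x"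
  by (simp_all add: rn_derivative_def)

lemma D_measurable [measurable]: "D \<in> borel_measurable \<mu>"
  and R_measurable [measurable]: "R k \<in> borel_measurable \<mu>"
  unfolding rn_derivative_def by measurable

lemma AE_check: "AE x in \<mu>. P x \<Longrightarrow> AE x in \<mu>. P (check x)"
  by (rule quasi_invariant_involution.AE_involution[OF check_involution])

lemma AE_translate: "AE x in \<mu>. P x \<Longrightarrow> AE x in \<mu>. P (x + \<delta> k)"
  by (rule quasi_invariant_involution.AE_involution[OF translate_involution])

lemma D_D: "AE x in \<mu>. D x * D (check x) = 1"
  using quasi_invariant_involution.jacobian_involution[OF check_involution]
  by (simp add: check_measure_eq)

text \<open>The cocycle identity for \<open>check\<close> and the translation by
  \<open>\<delta> k\<close>, which commute. Its square root matches the scalar factors arising from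
  the two orders of applying the symmetry and an operator \<open>J\<close>.\<close>

lemma D_R: "AE x in \<mu>. D x * R k (check x) = R k x * D (x + \<delta> k)"
  using jacobian_cocycle[OF check_involution translate_involution]
  by (simp add: check_measure_eq translate_eq check_add)

lemma AE_U_check: "AE x in \<mu>. hspace_eq (fiber U (check x)) (fiber U x)"
  using U_check by (simp add: family_ae_eq_def pullback_def)

lemma AE_U_translate: "AE x in \<mu>. hspace_eq (fiber U (x + \<delta> k)) (fiber U x)"
  using U_translate delta_in_Delta[of k] by (auto simp add: family_ae_eq_def pullback_def)

lemma V_eq: "hspace_eq (fiber U x) (fiber U y) \<Longrightarrow> hspace_eq (VC x) (VC y)"
  by (rule hspace_eq_complexify) simp_all

section \<open>The antilinear symmetry on measurable sections\<close>

definition S_fun :: "(binseq \<Rightarrow> 'u \<times> 'u) \<Rightarrow> binseq \<Rightarrow> 'u \<times> 'u" where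
  "S_fun f x = hscale (VC x) (of_real (sqrt (D x))) (conjugate (fiber U x) (f (check x)))"

lemma S_fun_cong:
  assumes "AE x in \<mu>. f x = g x"
  shows "AE x in \<mu>. S_fun f x = S_fun g x"
  using AE_check[OF assms] by eventually_elim (simp add: S_fun_def)

text \<open>Invariance under \<open>check\<close> is assumed for the real family, so the real and
  imaginary components are replaced separately by sections \<open>s'\<close> and \<open>t'\<close>.
  Conjugation and the measurable factor then stay within the sections of \<open>V\<close>.\<close>

lemma S_fun_section:
  assumes f: "f \<in> msections V"
  shows "ae_section \<mu> V (S_fun f)"
proof -
  obtain s t where st: "s \<in> msections U" "t \<in> msections U" and f_eq: "f = (\<lambda>x. (s x, t x))"
    using f unfolding complexify_family_def by auto
  have *: "\<exists>s'\<in>msections U. AE x in \<mu>. s (check x) = s' x" if "s \<in> msections U" for s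
  proof -
    have "(\<lambda>x. s (check x)) \<in> msections (pullback check U)"
      using that by (simp add: pullback_def)
    then show ?thesis by (rule family_ae_eq_section[OF U_check])
  qed
  obtain s' where s': "s' \<in> msections U" "AE x in \<mu>. s (check x) = s' x"
    using *[OF st(1)] by (elim bexE)
  obtain t' where t': "t' \<in> msections U" "AE x in \<mu>. t (check x) = t' x"
    using *[OF st(2)] by (elim bexE)
  have "(\<lambda>x. conjugate (fiber U x) (s' x, t' x)) \<in> msections V"
    using s'(1) msections_scale[OF U_family t'(1), of "- 1"]
    by (auto simp: conjugate_def complexify_family_def)
  then have "(\<lambda>x. hscale (fiber V x) (of_real (sqrt (D x))) (conjugate (fiber U x) (s' x, t' x)))
      \<in> msections V"
    by (rule msections_scale_measurable[OF V_family]) measurable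
  then show ?thesis
  proof (rule ae_section_cong[rotated, OF ae_sectionI])
    show "AE x in \<mu>. hscale (fiber V x) (of_real (sqrt (D x))) (conjugate (fiber U x) (s' x, t' x)) =
        S_fun f x"
      using s'(2) t'(2) by eventually_elim (simp add: S_fun_def f_eq)
  qed
qed

lemma S_fun_add:
  assumes f: "f \<in> msections V" and g: "g \<in> msections V"
  shows "AE x in \<mu>. S_fun (\<lambda>x. hadd (VC x) (f x) (g x)) x = hadd (VC x) (S_fun f x) (S_fun g x)"
  using AE_U_check
proof eventually_elim
  case (elim x)
  note eq = V_eq[OF elim]
  \<comment> \<open>The inner sum is formed in the fibre at \<open>check x\<close>, the conjugation
    and the outer sum in the fibre at \<open>x\<close>. Membership in both carriers allows the
    operations to be exchanged.\<close>
  have fx: "f (check x) \<in> hcarrier (VC (check x))" "f (check x) \<in> hcarrier (VC x)"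
    and gx: "g (check x) \<in> hcarrier (VC (check x))" "g (check x) \<in> hcarrier (VC x)"
    using V_closed[OF f, of "check x"] V_closed[OF g, of "check x"] hspace_eq_carrier[OF eq] by auto
  then show ?case
    by (simp add: S_fun_def hspace_eq_add[OF eq fx(1) gx(1)] conjugate_add conjugate_closed
        hilbert_space.scale_add_right[OF V_hilbert])
qed

lemma S_fun_scale:
  assumes f: "f \<in> msections V"
  shows "AE x in \<mu>. S_fun (\<lambda>x. hscale (VC x) a (f x)) x = hscale (VC x) (cnj a) (S_fun f x)"
  using AE_U_check
proof eventually_elim
  case (elim x)
  note eq = V_eq[OF elim]
  have fx: "f (check x) \<in> hcarrier (VC (check x))" "f (check x) \<in> hcarrier (VC x)"
    using V_closed[OF f, of "check x"] hspace_eq_carrier[OF eq] by auto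
  then show ?case
    by (simp add: S_fun_def hspace_eq_scale[OF eq fx(1)] conjugate_scale conjugate_closed
        hilbert_space.scale_scale[OF V_hilbert] mult.commute)
qed

text \<open>Pointwise form of norm preservation: the right side is the integrand to which
  \<open>integral_involution\<close> applies.\<close>

lemma S_fun_inner:
  assumes f: "f \<in> msections V"
  shows "AE x in \<mu>. hinner (VC x) (S_fun f x) (S_fun f x) =
    D x *\<^sub>R hinner (VC (check x)) (f (check x)) (f (check x))"
  using AE_U_check
proof eventually_elim
  case (elim x)
  note eq = V_eq[OF elim]
  have fx: "f (check x) \<in> hcarrier (VC (check x))" "f (check x) \<in> hcarrier (VC x)"
    using V_closed[OF f, of "check x"] hspace_eq_carrier[OF eq] by auto
  have "complex_of_real (sqrt (D x)) * complex_of_real (sqrt (D x)) = of_real (D x)"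
    by (simp flip: of_real_mult)
  \<comment> \<open>A vector paired with itself gives a real number, so the conjugation introduced
    by \<open>inner_conjugate\<close> has no effect.\<close>
  moreover have "cnj (hinner (VC x) (f (check x)) (f (check x))) = hinner (VC x) (f (check x)) (f (check x))"
    using hilbert_space.inner_conj[OF V_hilbert fx(2) fx(2)] by simp
  ultimately show ?case
    using fx by (simp add: S_fun_def conjugate_closed inner_conjugate V_scale_closed
        hilbert_space.inner_scale[OF V_hilbert] hilbert_space.inner_scale_right[OF V_hilbert]
        hspace_eq_inner[OF eq] scaleR_conv_of_real flip: mult.assoc)
qed

text \<open>The two conjugations cancel, and the two square roots multiply to 1 by
  \<open>D_D\<close>.\<close>

lemma S_fun_S_fun:
  assumes f: "f \<in> msections V"
  shows "AE x in \<mu>. S_fun (S_fun f) x = f x"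
  using AE_U_check D_D
proof eventually_elim
  case (elim x)
  note eq = V_eq[OF elim(1)]
  have fx: "f x \<in> hcarrier (VC x)" "f x \<in> hcarrier (VC (check x))"
    using V_closed[OF f, of x] hspace_eq_carrier[OF eq] by auto
  have "complex_of_real (sqrt (D x)) * complex_of_real (sqrt (D (check x))) = 1"
    using elim(2) by (simp flip: of_real_mult real_sqrt_mult)
  \<comment> \<open>The inner application scales and conjugates in the fibre at
    \<open>check x\<close>; this transfers both operations to the fibre at \<open>x\<close>.\<close>
  moreover have "hscale (VC (check x)) a (conjugate (fiber U (check x)) (f x)) =
      hscale (VC x) a (conjugate (fiber U x) (f x))" for a
    using hspace_eq_scale[OF eq conjugate_closed[OF U_hilbert fx(2)]]
      hspace_eq_conjugate[OF elim(1) fx(2)] by simp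
  ultimately show ?case
    using fx(1) by (simp add: S_fun_def conjugate_closed conjugate_scale conjugate_conjugate
        hilbert_space.scale_scale[OF V_hilbert] hilbert_space.scale_one[OF V_hilbert])
qed

section \<open>Commutation with the operators of the triple\<close>

text \<open>The common form of the \<open>J\<^sub>k\<close> and \<open>J\<^sub>k'\<close>, which differ only in the phase \<open>a\<close>.\<close>

definition phased_translation :: "(binseq \<Rightarrow> complex) \<Rightarrow> nat \<Rightarrow> (binseq \<Rightarrow> 'u \<times> 'u) \<Rightarrow> binseq \<Rightarrow> 'u \<times> 'u"
  where "phased_translation a k f x =
    hscale (VC x) (a x * of_real (sqrt (R k x))) (c k x (f (x + \<delta> k)))"

lemma phased_translation_cong:
  assumes "AE x in \<mu>. f x = g x"
  shows "AE x in \<mu>. phased_translation a k f x = phased_translation a k g x"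
  using AE_translate[OF assms, of k] by eventually_elim (simp add: phased_translation_def)

text \<open>Translation, \<open>c k\<close> and the measurable scalar are applied in turn; after
  each of the first two the function is replaced by a section equal to it almost everywhere.\<close>

lemma phased_translation_section:
  assumes f: "f \<in> msections V" and k: "k \<ge> 1" and a: "a \<in> borel_measurable \<mu>"
  shows "ae_section \<mu> V (phased_translation a k f)"
proof -
  have "(\<lambda>x. f (x + \<delta> k)) \<in> msections (pullback (\<lambda>x. x + \<delta> k) V)"
    using f by (simp add: pullback_def)
  then have "\<exists>s\<in>msections V. AE x in \<mu>. f (x + \<delta> k) = s x"
    by (rule family_ae_eq_section[OF bspec[OF V_translate delta_in_Delta]])
  then obtain s where s: "s \<in> msections V" "AE x in \<mu>. f (x + \<delta> k) = s x"
    by (elim bexE)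
  have "\<forall>s\<in>msections V. \<exists>t\<in>msections V. AE x in \<mu>. t x = c k x (s x)"
    using c_section k by simp
  then have "\<exists>t\<in>msections V. AE x in \<mu>. t x = c k x (s x)"
    using s(1) by (rule bspec)
  then obtain t where t: "t \<in> msections V" "AE x in \<mu>. t x = c k x (s x)"
    by (elim bexE)
  have "(\<lambda>x. a x * of_real (sqrt (R k x))) \<in> borel_measurable \<mu>"
    using a R_measurable[of k] by measurable
  then have "(\<lambda>x. hscale (fiber V x) (a x * of_real (sqrt (R k x))) (t x)) \<in> msections V"
    by (rule msections_scale_measurable[OF V_family t(1)])
  then show ?thesis
  proof (rule ae_section_cong[rotated, OF ae_sectionI])
    show "AE x in \<mu>. hscale (fiber V x) (a x * of_real (sqrt (R k x))) (t x) =
        phased_translation a k f x"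
      using s(2) t(2) by eventually_elim (simp add: phased_translation_def)
  qed
qed

text \<open>The condition on \<open>a\<close> is what compensates the sign \<open>(- 1) ^ k\<close>
  in the hypothesis on \<open>c\<close>; the densities are matched by \<open>D_R\<close>. Both sides
  reduce to a scalar times \<open>c k x\<close> applied to the conjugate of
  \<open>f (check x + \<delta> k)\<close>.\<close>

lemma S_fun_phased_translation:
  assumes f: "f \<in> msections V" and k: "k \<ge> 1"
    and a: "\<And>x. (- 1) ^ k * cnj (a (check x)) = a x"
  shows "AE x in \<mu>. S_fun (phased_translation a k f) x = phased_translation a k (S_fun f) x"
proof -
  have unitary: "AE x in \<mu>. unitary_op (VC x) (VC (x + \<delta> k)) (c k x)"
    using c_unitary k by simp
  have conj: "AE x in \<mu>. \<forall>v\<in>hcarrier (VC x). conjugate_op (fiber U x) (c k x) v =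
      hscale (VC x) ((- 1) ^ k) (c k (check x) v)"
    using c_conjugate k by blast
  show ?thesis
    using AE_U_check AE_U_translate[of k] AE_check[OF AE_U_translate[of k]] unitary
      AE_check[OF unitary] AE_check[OF conj] D_R[of k]
  proof eventually_elim
    case (elim x)
    define y where "y = check x"
    define w where "w = f (y + \<delta> k)"
    \<comment> \<open>The fibres at \<open>x\<close>, \<open>y\<close>,
      \<open>x + \<delta> k\<close> and \<open>y + \<delta> k\<close> are identified, the last one
      through the fibre at \<open>y\<close>. Hence \<open>c k x\<close> and \<open>c k y\<close>
      both act on one carrier \<open>?C\<close>.\<close>
    note U_y = elim(1)[folded y_def] and U_x' = elim(2)
      and U_y' = hspace_eq_trans[OF elim(3,1), folded y_def]
    note V_y = V_eq[OF U_y] and V_x' = V_eq[OF U_x'] and V_y' = V_eq[OF U_y']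
    have check_y: "check y = x" by (simp add: y_def)
    let ?C = "hcarrier (VC x)" and ?scale = "hscale (VC x)" and ?conj = "conjugate (fiber U x)"
    have C: "hcarrier (VC y) = ?C" "hcarrier (VC (x + \<delta> k)) = ?C" "hcarrier (VC (y + \<delta> k)) = ?C"
      using hspace_eq_carrier[OF V_y] hspace_eq_carrier[OF V_x'] hspace_eq_carrier[OF V_y'] by auto
    have w: "w \<in> ?C" using V_closed[OF f, of "y + \<delta> k"] C by (simp add: w_def)
    then have conj_w: "?conj w \<in> ?C" by (simp add: conjugate_closed)
    have c_closed: "c k x u \<in> ?C" "c k y u \<in> ?C" if "u \<in> ?C" for u
      using elim(4) elim(5)[folded y_def] that bij_betw_apply[of "c k x" ?C ?C u]
        bij_betw_apply[of "c k y" ?C ?C u]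
      by (auto simp: unitary_op_def C)
    have c_scale: "c k x (?scale b u) = ?scale b (c k x u)" if "u \<in> ?C" for b u
    proof -
      have "c k x (?scale b u) = hscale (VC (x + \<delta> k)) b (c k x u)"
        using elim(4) that by (auto simp: unitary_op_def)
      also have "\<dots> = ?scale b (c k x u)"
        by (rule hspace_eq_scale[OF V_x']) (simp add: C c_closed that)
      finally show ?thesis .
    qed
    \<comment> \<open>The hypothesis is used at the point \<open>y\<close> and the vector
      \<open>?conj w\<close>: the inner conjugation of \<open>conjugate_op\<close> restores
      \<open>w\<close>, and \<open>check y = x\<close> puts \<open>c k x\<close> on the
      right.\<close>
    have c_conj: "?conj (c k y w) = ?scale ((- 1) ^ k) (c k x (?conj w))"
    proof -
      have "conjugate (fiber U y) (c k y (conjugate (fiber U y) (?conj w))) =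
          hscale (VC y) ((- 1) ^ k) (c k x (?conj w))"
        using elim(6)[folded y_def] conj_w check_y by (simp add: conjugate_op_def C)
      then show ?thesis
        using w conj_w hspace_eq_conjugate[OF U_y] hspace_eq_scale[OF V_y]
        by (simp add: C c_closed conjugate_conjugate)
    qed
    \<comment> \<open>The scalars accumulated by the two orders of composition. Their real parts
      under the roots agree by \<open>D_R\<close>, their phases by the condition on
      \<open>a\<close>.\<close>
    have coeff: "complex_of_real (sqrt (D x)) * cnj (a y * of_real (sqrt (R k y))) * (- 1) ^ k =
        a x * of_real (sqrt (R k x)) * of_real (sqrt (D (x + \<delta> k)))"
    proof -
      have "sqrt (D x) * sqrt (R k y) = sqrt (R k x) * sqrt (D (x + \<delta> k))"
        using elim(7) by (simp add: y_def flip: real_sqrt_mult)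
      then have eq: "complex_of_real (sqrt (D x)) * of_real (sqrt (R k y)) =
          of_real (sqrt (R k x)) * of_real (sqrt (D (x + \<delta> k)))"
        by (simp flip: of_real_mult)
      have "complex_of_real (sqrt (D x)) * cnj (a y * of_real (sqrt (R k y))) * (- 1) ^ k =
          ((- 1) ^ k * cnj (a y)) * (of_real (sqrt (D x)) * of_real (sqrt (R k y)))"
        by (simp add: ac_simps)
      also have "\<dots> = a x * (of_real (sqrt (R k x)) * of_real (sqrt (D (x + \<delta> k))))"
        by (simp only: eq, simp only: a y_def)
      finally show ?thesis by (simp add: ac_simps)
    qed
    have "S_fun (phased_translation a k f) x =
        ?scale (of_real (sqrt (D x))) (?conj (?scale (a y * of_real (sqrt (R k y))) (c k y w)))"
      using w by (simp add: S_fun_def phased_translation_def hspace_eq_scale[OF V_y] C c_closed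
          flip: y_def w_def)
    also have "\<dots> = ?scale (of_real (sqrt (D x)) * cnj (a y * of_real (sqrt (R k y))) * (- 1) ^ k)
        (c k x (?conj w))"
      using w conj_w by (simp add: conjugate_scale c_closed c_conj V_scale_closed mult.assoc
          hilbert_space.scale_scale[OF V_hilbert])
    also have "\<dots> = ?scale (a x * of_real (sqrt (R k x))) (c k x (?scale (of_real (sqrt (D (x + \<delta> k))))
        (?conj w)))"
      unfolding coeff
      using conj_w by (simp add: c_scale c_closed hilbert_space.scale_scale[OF V_hilbert])
    also have "\<dots> = phased_translation a k (S_fun f) x"
      using w conj_w hspace_eq_conjugate[OF U_x', of w]
      by (simp add: S_fun_def phased_translation_def hspace_eq_scale[OF V_x'] C check_add
          flip: y_def w_def)
    finally show ?case .
  qed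
qed

section \<open>The symmetry on the direct integral\<close>

definition S :: "(binseq \<Rightarrow> 'u \<times> 'u) set \<Rightarrow> (binseq \<Rightarrow> 'u \<times> 'u) set" where
  "S = on_classes \<mu> V S_fun"

lemma S_ae_class: "ae_section \<mu> V f \<Longrightarrow> S (ae_class \<mu> V f) = ae_class \<mu> V (S_fun f)"
  unfolding S_def by (rule on_classes_ae_class[OF S_fun_cong])

lemma S_on_classes_phased_translation:
  assumes f: "f \<in> msections V" and k: "k \<ge> 1" and a: "a \<in> borel_measurable \<mu>"
    "\<And>x. (- 1) ^ k * cnj (a (check x)) = a x"
  shows "S (on_classes \<mu> V (phased_translation a k) (ae_class \<mu> V f)) =
    on_classes \<mu> V (phased_translation a k) (S (ae_class \<mu> V f))"
proof -
  note f' = ae_sectionI[OF f, of \<mu>]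
  have on_classes: "on_classes \<mu> V (phased_translation a k) (ae_class \<mu> V g) =
      ae_class \<mu> V (phased_translation a k g)" if "ae_section \<mu> V g" for g
    using phased_translation_cong that by (rule on_classes_ae_class)
  have "S (on_classes \<mu> V (phased_translation a k) (ae_class \<mu> V f)) =
      ae_class \<mu> V (S_fun (phased_translation a k f))"
    using phased_translation_section[OF f k a(1)] by (simp add: on_classes[OF f'] S_ae_class)
  also have "\<dots> = ae_class \<mu> V (phased_translation a k (S_fun f))"
    by (rule ae_class_cong, rule S_fun_phased_translation) (fact f k a(2))+
  also have "\<dots> = on_classes \<mu> V (phased_translation a k) (S (ae_class \<mu> V f))"
    using S_fun_section[OF f] by (simp add: on_classes S_ae_class[OF f'])
  finally show ?thesis .
qed

lemma S_J:
  assumes f: "f \<in> msections V" and k: "k \<ge> 1"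
  shows "S (J \<mu> V c k (ae_class \<mu> V f)) = J \<mu> V c k (S (ae_class \<mu> V f))"
proof -
  let ?a = "\<lambda>x. - \<i> * (- 1) ^ entry_sum x (k - 1)"
  have "J \<mu> V c k = on_classes \<mu> V (phased_translation ?a k)"
    unfolding J_def by (rule arg_cong[where f = "on_classes \<mu> V"])
      (simp add: fun_eq_iff J_fun_def phased_translation_def)
  moreover have "?a \<in> borel_measurable \<mu>"
    using sign_entry_sum_measurable by (intro measurable_\<mu> borel_measurable_times) auto
  moreover have "(- 1) ^ k * cnj (?a (check x)) = ?a x" for x
  proof -
    \<comment> \<open>With \<open>k = Suc n\<close> the phase sums \<open>n\<close> entries, so
      \<open>check\<close> contributes only \<open>(- 1) ^ n\<close>; the remaining factor of
      \<open>(- 1) ^ k\<close> cancels against the sign from conjugating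
      \<open>- \<i>\<close>.\<close>
    obtain n where n: "k = Suc n" using k by (cases k) auto
    have "(- 1) ^ n * ((- 1) ^ n * z) = z" for z :: complex
      by (simp flip: mult.assoc power_mult_distrib)
    then show ?thesis by (simp add: sign_entry_sum_check n)
  qed
  ultimately show ?thesis
    using S_on_classes_phased_translation[OF f k, of ?a] by (simp only:)
qed

lemma S_J':
  assumes f: "f \<in> msections V" and k: "k \<ge> 1"
  shows "S (J' \<mu> V c k (ae_class \<mu> V f)) = J' \<mu> V c k (S (ae_class \<mu> V f))"
proof -
  let ?a = "\<lambda>x. (- 1) ^ entry_sum x k :: complex"
  have "J' \<mu> V c k = on_classes \<mu> V (phased_translation ?a k)"
    unfolding J'_def by (rule arg_cong[where f = "on_classes \<mu> V"])
      (simp add: fun_eq_iff J'_fun_def phased_translation_def)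
  moreover have "?a \<in> borel_measurable \<mu>"
    by (intro measurable_\<mu> sign_entry_sum_measurable)
  moreover have "(- 1) ^ k * cnj (?a (check x)) = ?a x" for x
  proof -
    have "(- 1) ^ k * ((- 1) ^ k * z) = z" for z :: complex
      by (simp flip: mult.assoc power_mult_distrib)
    then show ?thesis by (simp add: sign_entry_sum_check)
  qed
  ultimately show ?thesis
    using S_on_classes_phased_translation[OF f k, of ?a] by (simp only:)
qed

abbreviation L2 :: "(complex, (binseq \<Rightarrow> 'u \<times> 'u) set) hspace" where
  "L2 \<equiv> direct_integral \<mu> V"

text \<open>Membership in the direct integral concerns the real squared norm, whereas
  \<open>hnorm\<close> comes from the complex inner product. The substitution is therefore carried
  out for both, through \<open>norm_g\<close> and \<open>inner_g\<close>.\<close>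

lemma
  assumes f: "f \<in> msections V"
    and int: "integrable \<mu> (\<lambda>x. (hnorm (fiber V x) (f x))\<^sup>2)"
  shows S_closed: "S (ae_class \<mu> V f) \<in> hcarrier L2"
    and S_norm: "hnorm L2 (S (ae_class \<mu> V f)) = hnorm L2 (ae_class \<mu> V f)"
proof -
  \<comment> \<open>\<open>S_fun f\<close> is a section only up to a null set; \<open>g\<close> is a
    genuine section in its class, which supplies the measurability needed under the
    integrals.\<close>
  obtain g where g: "g \<in> msections V" and g_eq: "AE x in \<mu>. g x = S_fun f x"
    using S_fun_section[OF f] unfolding ae_section_def by (elim bexE)
  have S_f: "S (ae_class \<mu> V f) = ae_class \<mu> V g"
    using S_ae_class[OF ae_sectionI[OF f]] ae_class_cong[OF g_eq, of V] by simp
  let ?h = "\<lambda>x. hinner (fiber V x) (f x) (f x)"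
  have h: "?h \<in> borel_measurable \<mu>" by (rule msections_inner_measurable[OF V_family f f])
  have inner_g: "AE x in \<mu>. hinner (fiber V x) (g x) (g x) = D x *\<^sub>R ?h (check x)"
    using g_eq S_fun_inner[OF f] by eventually_elim simp
  have norm_g: "AE x in \<mu>. (hnorm (fiber V x) (g x))\<^sup>2 = D x *\<^sub>R (hnorm (fiber V (check x)) (f (check x)))\<^sup>2"
    using inner_g
  proof eventually_elim
    case (elim x)
    then have "complex_of_real ((hnorm (VC x) (g x))\<^sup>2) =
        of_real (D x *\<^sub>R (hnorm (VC (check x)) (f (check x)))\<^sup>2)"
      using V_closed[OF g, of x] V_closed[OF f, of "check x"]
      by (simp add: hilbert_space.norm_squared[OF V_hilbert] scaleR_conv_of_real)
    then show ?case unfolding of_real_eq_iff by simp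
  qed
  note jac = quasi_invariant_involution.integrable_involution[OF check_involution]
    quasi_invariant_involution.integral_involution[OF check_involution]
  have norm_measurable: "(\<lambda>x. (hnorm (fiber V x) (s x))\<^sup>2) \<in> borel_measurable \<mu>" if "s \<in> msections V" for s
    by (intro borel_measurable_power msections_norm_measurable[OF V_family that])
  have "integrable \<mu> (\<lambda>x. D x *\<^sub>R (hnorm (fiber V (check x)) (f (check x)))\<^sup>2)"
    using jac(1)[OF norm_measurable[OF f]] int by (simp add: check_measure_eq)
  then have "integrable \<mu> (\<lambda>x. (hnorm (fiber V x) (g x))\<^sup>2)"
    using norm_g by (subst integrable_cong_AE[OF norm_measurable[OF g] borel_measurable_integrable]) auto
  with g show "S (ae_class \<mu> V f) \<in> hcarrier L2"
    unfolding S_f by (auto simp: direct_integral_def)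
  have "(LINT x|\<mu>. hinner (fiber V x) (g x) (g x)) = (LINT x|\<mu>. D x *\<^sub>R ?h (check x))"
  proof (rule integral_cong_AE[OF _ _ inner_g])
    show "(\<lambda>x. hinner (fiber V x) (g x) (g x)) \<in> borel_measurable \<mu>"
      by (rule msections_inner_measurable[OF V_family g g])
    show "(\<lambda>x. D x *\<^sub>R ?h (check x)) \<in> borel_measurable \<mu>"
      by (intro borel_measurable_scaleR D_measurable
          measurable_compose[OF quasi_invariant_involution.involution_measurable[OF check_involution] h])
  qed
  also have "\<dots> = (LINT x|\<mu>. ?h x)"
    using jac(2)[OF h] by (simp add: check_measure_eq)
  finally have "hinner L2 (ae_class \<mu> V g) (ae_class \<mu> V g) = hinner L2 (ae_class \<mu> V f) (ae_class \<mu> V f)"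
    by (simp only: direct_integral_inner[OF V_family] f g)
  then show "hnorm L2 (S (ae_class \<mu> V f)) = hnorm L2 (ae_class \<mu> V f)"
    by (simp add: S_f hnorm_def)
qed

lemma S_add:
  assumes f: "f \<in> msections V" and g: "g \<in> msections V"
  shows "S (hadd L2 (ae_class \<mu> V f) (ae_class \<mu> V g)) =
    hadd L2 (S (ae_class \<mu> V f)) (S (ae_class \<mu> V g))"
proof -
  have "S (hadd L2 (ae_class \<mu> V f) (ae_class \<mu> V g)) =
      ae_class \<mu> V (S_fun (\<lambda>x. hadd (VC x) (f x) (g x)))"
    using S_ae_class[OF ae_sectionI[OF msections_add[OF V_family f g]]]
    by (simp add: direct_integral_add ae_sectionI f g)
  also have "\<dots> = ae_class \<mu> V (\<lambda>x. hadd (VC x) (S_fun f x) (S_fun g x))"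
    by (rule ae_class_cong[OF S_fun_add[OF f g]])
  finally show ?thesis
    by (simp add: S_ae_class ae_sectionI f g direct_integral_add S_fun_section)
qed

lemma S_scale:
  assumes f: "f \<in> msections V"
  shows "S (hscale L2 a (ae_class \<mu> V f)) = hscale L2 (cnj a) (S (ae_class \<mu> V f))"
proof -
  have "S (hscale L2 a (ae_class \<mu> V f)) = ae_class \<mu> V (S_fun (\<lambda>x. hscale (VC x) a (f x)))"
    using S_ae_class[OF ae_sectionI[OF msections_scale[OF V_family f]]]
    by (simp add: direct_integral_scale ae_sectionI f)
  also have "\<dots> = ae_class \<mu> V (\<lambda>x. hscale (VC x) (cnj a) (S_fun f x))"
    by (rule ae_class_cong[OF S_fun_scale[OF f]])
  finally show ?thesis
    by (simp add: S_ae_class ae_sectionI f direct_integral_scale S_fun_section)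
qed

lemma S_S:
  assumes f: "f \<in> msections V"
  shows "S (S (ae_class \<mu> V f)) = ae_class \<mu> V f"
  using ae_class_cong[OF S_fun_S_fun[OF f]]
  by (simp add: S_ae_class ae_sectionI f S_fun_section)

text \<open>The scalar is real, so conjugation passes through it; applying the involution
  \<open>conjugate\<close> to both sides turns the fixed-point equation into the equation of the
  real form.\<close>

lemma S_fixed_iff:
  assumes f: "f \<in> msections V"
  shows "S (ae_class \<mu> V f) = ae_class \<mu> V f \<longleftrightarrow>
    (AE x in \<mu>. conjugate (fiber U x) (f x) = hscale (VC x) (of_real (sqrt (D x))) (f (check x)))"
proof -
  have "S (ae_class \<mu> V f) = ae_class \<mu> V f \<longleftrightarrow> (AE x in \<mu>. S_fun f x = f x)"
    by (simp add: S_ae_class ae_sectionI f ae_class_eq_iff S_fun_section)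
  also have "\<dots> \<longleftrightarrow> (AE x in \<mu>. conjugate (fiber U x) (f x) =
      hscale (VC x) (of_real (sqrt (D x))) (f (check x)))"
  proof (rule eventually_cong[OF AE_U_check])
    fix x assume "hspace_eq (fiber U (check x)) (fiber U x)"
    then have w: "f (check x) \<in> hcarrier (VC x)"
      using V_closed[OF f, of "check x"] hspace_eq_carrier[OF V_eq] by blast
    have fx: "f x \<in> hcarrier (VC x)" by (rule V_closed[OF f])
    let ?r = "hscale (VC x) (of_real (sqrt (D x))) (f (check x))"
    have "S_fun f x = conjugate (fiber U x) ?r"
      using w by (simp add: S_fun_def conjugate_scale)
    moreover have "conjugate (fiber U x) ?r = f x \<longleftrightarrow> conjugate (fiber U x) (f x) = ?r"
      using conjugate_conjugate[OF U_hilbert fx] conjugate_conjugate[OF U_hilbert V_scale_closed[OF w]]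
      by metis
    ultimately show "S_fun f x = f x \<longleftrightarrow> conjugate (fiber U x) (f x) = ?r" by simp
  qed
  finally show ?thesis .
qed

text \<open>\<open>real_form_set\<close> asks for one suitable representative. By
  \<open>S_fixed_iff\<close> the condition on any representative is equivalent to
  \<open>S A = A\<close>, so the choice is immaterial.\<close>

lemma real_form_set_eq: "real_form_set \<mu> U = {A \<in> hcarrier L2. S A = A}"
proof -
  have "(\<exists>f\<in>A. AE x in \<mu>. conjugate (fiber U x) (f x) =
      hscale (VC x) (of_real (sqrt (D x))) (f (check x))) \<longleftrightarrow> S A = A" (is "?fixed \<longleftrightarrow> _")
    if A: "A \<in> hcarrier L2" for A
  proof
    assume ?fixed
    then obtain f where f: "f \<in> A" and eq: "AE x in \<mu>. conjugate (fiber U x) (f x) =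
        hscale (VC x) (of_real (sqrt (D x))) (f (check x))"
      by (elim bexE)
    from A obtain g where g: "g \<in> msections V" "A = ae_class \<mu> V g"
      by (rule direct_integral_carrierE)
    from f g have f': "f \<in> msections V" and "AE x in \<mu>. f x = g x"
      by (simp_all add: ae_class_def)
    with g have "A = ae_class \<mu> V f" using ae_class_cong by metis
    then show "S A = A" using S_fixed_iff[OF f'] eq by simp
  next
    assume fixed: "S A = A"
    from A obtain g where g: "g \<in> msections V" "A = ae_class \<mu> V g"
      by (rule direct_integral_carrierE)
    then have "g \<in> A" by (simp add: ae_class_def)
    moreover have "AE x in \<mu>. conjugate (fiber U x) (g x) =
        hscale (VC x) (of_real (sqrt (D x))) (g (check x))"
      using S_fixed_iff[OF g(1)] fixed g(2) by simp
    ultimately show ?fixed by (intro bexI[of _ g])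
  qed
  then show ?thesis unfolding real_form_set_def by (intro Collect_cong conj_cong refl)
qed

lemma invariant_real_form_real_form_set:
  "invariant_real_form L2 ({J \<mu> V c k | k. k \<ge> 1} \<union> {J' \<mu> V c k | k. k \<ge> 1}) (real_form_set \<mu> U)"
  unfolding invariant_real_form_def
proof (intro exI[of _ S] conjI allI ballI)
  fix A B assume "A \<in> hcarrier L2" and "B \<in> hcarrier L2"
  then show "S (hadd L2 A B) = hadd L2 (S A) (S B)"
    by (elim direct_integral_carrierE) (simp add: S_add)
next
  fix T A assume T: "T \<in> {J \<mu> V c k | k. k \<ge> 1} \<union> {J' \<mu> V c k | k. k \<ge> 1}"
    and "A \<in> hcarrier L2"
  then obtain f where "f \<in> msections V" "A = ae_class \<mu> V f"
    by (elim direct_integral_carrierE)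
  with T show "S (T A) = T (S A)"
    by (auto simp: S_J S_J')
next
  fix A a assume "A \<in> hcarrier L2"
  then obtain f where f: "f \<in> msections V" "A = ae_class \<mu> V f"
    "integrable \<mu> (\<lambda>x. (hnorm (fiber V x) (f x))\<^sup>2)"
    by (rule direct_integral_carrierE)
  show "S A \<in> hcarrier L2" "hnorm L2 (S A) = hnorm L2 A"
    using S_closed[OF f(1,3)] S_norm[OF f(1,3)] f(2) by simp_all
  show "S (hscale L2 a A) = hscale L2 (cnj a) (S A)" "S (S A) = A"
    using S_scale[OF f(1)] S_S[OF f(1)] f(2) by simp_all
qed (rule real_form_set_eq)

end

theorem theorem3p7:
  fixes \<mu> :: "binseq measure"
    and U :: "(binseq, real, 'u) hfamily"
    and \<nu> :: "binseq \<Rightarrow> enat"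
    and c :: "nat \<Rightarrow> binseq \<Rightarrow> 'u \<times> 'u \<Rightarrow> 'u \<times> 'u"
  assumes "measurable_family (\<lambda>a::real. a) \<mu> U"
    and "\<forall>d\<in>\<Delta>. family_ae_eq \<mu> (pullback (\<lambda>x. x + d) U) U"
    and "family_ae_eq \<mu> (pullback check U) U"
    and "gw_triple \<mu> (complexify_family U) \<nu> c"
    and "equivalent_measures (check_measure \<mu>) \<mu>"
    and "AE x in \<mu>. \<nu> (check x) = \<nu> x"
    and "\<forall>k\<ge>1. AE x in \<mu>. \<forall>v\<in>hcarrier (complexify (fiber U x)).
           conjugate_op (fiber U x) (c k x) v =
             hscale (complexify (fiber U x)) ((- 1) ^ k) (c k (check x) v)"
  shows "invariant_real_form (direct_integral \<mu> (complexify_family U))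
           ({J \<mu> (complexify_family U) c k | k. k \<ge> 1} \<union>
            {J' \<mu> (complexify_family U) c k | k. k \<ge> 1})
           (real_form_set \<mu> U)"
proof -
  interpret conjugation_symmetric_triple \<mu> U \<nu> c
    by unfold_locales (fact assms)+
  show ?thesis by (rule invariant_real_form_real_form_set)
qed

end
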